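(* The algebra $D(R_A)$ is simple if and only if the semigroup $\mathbb NA$ is scored and, for every $\boldsymbol\alpha\in\mathbb C^d$, the set $\mathbb R_{>0}(\boldsymbol\alpha)$ is nonempty.
   Context: $A\subset\mathbb Z^d$ is a finite set generating the group $\mathbb Z^d$; $\mathbb NA$ its monoid; $R_A=\mathbb C[\mathbb NA]\subseteq\mathbb C[t_1^{\pm1},\dots,t_d^{\pm1}]$; $D(R_A)=\{P\in\mathbb C[t^{\pm1}]\langle\partial_1,\dots,\partial_d\rangle:P(R_A)\subseteq R_A\}$; simple means no two-sided ideals other than $0$ and $D(R_A)$. For a facet $\sigma$ of the cone $\mathbb R_{\ge0}A$, $F_\sigma$ is the unique linear form (extended $\mathbb C$-linearly) with $F_\sigma(\mathbb R_{\ge0}A)\ge0$, $F_\sigma(\sigma)=0$, $F_\sigma(\mathbb Z^d)=\mathbb Z$. $\mathbb NA$ is scored if $\mathbb NA=\bigcap_{\sigma\text{ facet}}\{\mathbf a\in\mathbb Z^d:F_\sigma(\mathbf a)\in F_\sigma(\mathbb NA)\}$. $\mathcal F_+(\boldsymbol\alpha)=\{\sigma:F_\sigma(\boldsymbol\alpha)\in F_\sigma(\mathbb NA)\}$, $\mathcal F_-(\boldsymbol\alpha)=\{\sigma:F_\sigma(\boldsymbol\alpha)\in\mathbb Z\setminus F_\sigma(\mathbb NA)\}$, $\mathbb R_{>0}(\boldsymbol\alpha)=\{\boldsymbol\gamma\in\mathbb R^d:F_\sigma(\boldsymbol\gamma)>0\ (\sigma\in\mathcal F_+(\boldsymbol\alpha)),\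 F_\sigma(\boldsymbol\gamma)<0\ (\sigma\in\mathcal F_-(\boldsymbol\alpha))\}$. *)

theory Defs
  imports "HOL-Analysis.Analysis" "HOL-Library.Poly_Mapping"
begin

text \<open>Lattice Z^d is int^'n, real space R^d is real^'n, complex space C^d is complex^'n.
 Laurent polynomials C[t_1^{+-1},...,t_d^{+-1}] are finitely supported maps int^'n =>0 complex
 (multiplication = convolution, i.e. t^a * t^b = t^(a+b)).\<close>

type_synonym 'n laurent = "(int^'n) \<Rightarrow>\<^sub>0 complex"

definition lat_pt :: "int^'n \<Rightarrow> real^'n" where
  "lat_pt a = (\<chi> i. real_of_int (a $ i))"

definition int_span :: "(int^'n) set \<Rightarrow> (int^'n) set" where
  "int_span A = {\<Sum>a\<in>A. (\<chi> i. k a * a $ i) | k. True}"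

definition NA :: "(int^'n) set \<Rightarrow> (int^'n) set" where
  "NA A = {\<Sum>a\<in>A. (\<chi> i. int (k a) * a $ i) | k. True}"

definition cone_A :: "(int^'n) set \<Rightarrow> (real^'n) set" where
  "cone_A A = {\<Sum>a\<in>A. c a *\<^sub>R lat_pt a | c. \<forall>a\<in>A. 0 \<le> c a}"

text \<open>The primitive linear form F_sigma (as its coefficient vector w, F(x) = w . x).\<close>
definition Fvec :: "(int^'n) set \<Rightarrow> (real^'n) set \<Rightarrow> real^'n" where
  "Fvec A \<sigma> = (THE w. (\<forall>x\<in>cone_A A. 0 \<le> w \<bullet> x) \<and> (\<forall>x\<in>\<sigma>. w \<bullet> x = 0)
                      \<and> (\<lambda>z. w \<bullet> lat_pt z) ` UNIV = \<int>)"

definition F :: "(int^'n) set \<Rightarrow> (real^'n) set \<Rightarrow> real^'n \<Rightarrow> real" where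
  "F A \<sigma> x = Fvec A \<sigma> \<bullet> x"

definition Fc :: "(int^'n) set \<Rightarrow> (real^'n) set \<Rightarrow> complex^'n \<Rightarrow> complex" where
  "Fc A \<sigma> \<alpha> = (\<Sum>i\<in>UNIV. complex_of_real (Fvec A \<sigma> $ i) * \<alpha> $ i)"

definition facets :: "(int^'n) set \<Rightarrow> (real^'n) set set" where
  "facets A = {\<sigma>. \<sigma> facet_of cone_A A}"

definition FNA :: "(int^'n) set \<Rightarrow> (real^'n) set \<Rightarrow> real set" where
  "FNA A \<sigma> = (\<lambda>a. F A \<sigma> (lat_pt a)) ` NA A"

definition scored :: "(int^'n) set \<Rightarrow> bool" where
  "scored A \<longleftrightarrow> NA A = (\<Inter>\<sigma>\<in>facets A. {a. F A \<sigma> (lat_pt a) \<in> FNA A \<sigma>})"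

definition Fplus :: "(int^'n) set \<Rightarrow> complex^'n \<Rightarrow> (real^'n) set set" where
  "Fplus A \<alpha> = {\<sigma>\<in>facets A. Fc A \<sigma> \<alpha> \<in> complex_of_real ` FNA A \<sigma>}"

definition Fminus :: "(int^'n) set \<Rightarrow> complex^'n \<Rightarrow> (real^'n) set set" where
  "Fminus A \<alpha> = {\<sigma>\<in>facets A. Fc A \<sigma> \<alpha> \<in> \<int> \<and> Fc A \<sigma> \<alpha> \<notin> complex_of_real ` FNA A \<sigma>}"

definition Rpos :: "(int^'n) set \<Rightarrow> complex^'n \<Rightarrow> (real^'n) set" where
  "Rpos A \<alpha> = {\<gamma>. (\<forall>\<sigma>\<in>Fplus A \<alpha>. F A \<sigma> \<gamma> > 0) \<and> (\<forall>\<sigma>\<in>Fminus A \<alpha>. F A \<sigma> \<gamma> < 0)}"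

definition pd :: "'n \<Rightarrow> 'n::finite laurent \<Rightarrow> 'n laurent" where
  "pd i f = (\<Sum>a\<in>Poly_Mapping.keys f. Poly_Mapping.single (a - axis i 1) (of_int (a $ i) * Poly_Mapping.lookup f a))"

text \<open>C[t^{+-1}]<d_1,...,d_d>: the algebra of operators on Laurent polynomials generated by
  multiplication by (scalar multiples of) monomials and the partial derivatives.\<close>
inductive_set weyl_ops :: "('n::finite laurent \<Rightarrow> 'n laurent) set" where
  mult: "(\<lambda>f. Poly_Mapping.single a c * f) \<in> weyl_ops"
| deriv: "pd i \<in> weyl_ops"
| add: "P \<in> weyl_ops \<Longrightarrow> Q \<in> weyl_ops \<Longrightarrow> (\<lambda>f. P f + Q f) \<in> weyl_ops"
| comp: "P \<in> weyl_ops \<Longrightarrow> Q \<in> weyl_ops \<Longrightarrow> P \<circ> Q \<in> weyl_ops"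

definition R_A :: "(int^'n) set \<Rightarrow> 'n laurent set" where
  "R_A A = {f. Poly_Mapping.keys f \<subseteq> NA A}"

definition D_R :: "(int^'n::finite) set \<Rightarrow> ('n laurent \<Rightarrow> 'n laurent) set" where
  "D_R A = {P \<in> weyl_ops. \<forall>f\<in>R_A A. P f \<in> R_A A}"

definition two_sided_ideal :: "(('a \<Rightarrow> 'a::ab_group_add) set) \<Rightarrow> ('a \<Rightarrow> 'a) set \<Rightarrow> bool" where
  "two_sided_ideal D I \<longleftrightarrow> I \<subseteq> D \<and> (\<lambda>_. 0) \<in> I \<and> (\<forall>P\<in>I. \<forall>Q\<in>I. (\<lambda>f. P f - Q f) \<in> I)
     \<and> (\<forall>P\<in>D. \<forall>Q\<in>I. P \<circ> Q \<in> I \<and> Q \<circ> P \<in> I)"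

definition simple_alg :: "(('a \<Rightarrow> 'a::ab_group_add) set) \<Rightarrow> bool" where
  "simple_alg D \<longleftrightarrow> (\<forall>I. two_sided_ideal D I \<longrightarrow> I = {\<lambda>_. 0} \<or> I = D)"

end

theory Submission
  imports Defs "HOL-Library.Function_Algebras" "HOL-Computational_Algebra.Fundamental_Theorem_Algebra"
begin

text \<open>\<open>D(R\<^sub>A)\<close> is graded, its part of degree \<open>a\<close> consisting of the \<open>t\<^sup>a f(\<theta>)\<close> such that \<open>f\<close> vanishes at all
  \<open>b \<in> \<nat>A\<close> with \<open>a + b \<notin> \<nat>A\<close>. By density of \<open>\<nat>A \<inter> \<sigma>\<close> in the hyperplane of a facet, such an \<open>f\<close> vanishes
  at every \<open>\<beta> \<in> \<complex>\<^sup>d\<close> with \<open>F\<^sub>\<sigma>(\<beta>) \<in> F\<^sub>\<sigma>(\<nat>A)\<close> and \<open>F\<^sub>\<sigma>(\<beta> + a) \<notin> F\<^sub>\<sigma>(\<nat>A)\<close>, so \<open>\<F>\<^sub>+\<close> can only grow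
  along the action of \<open>D(R\<^sub>A)\<close> on \<open>t\<^sup>\<alpha> \<complex>[t\<^sup>\<plusminus>\<^sup>1]\<close>.

  If \<open>D(R\<^sub>A)\<close> is simple, then every nonzero \<open>D(R\<^sub>A)\<close>-module has zero annihilator. The scored closure
  modulo \<open>\<nat>A\<close>, and the points of \<open>\<alpha> + \<int>\<^sup>d\<close> with the same \<open>\<F>\<^sub>+\<close> as \<open>\<alpha>\<close>, both span such modules; the first
  set always lies in finitely many hyperplanes, and the second does if \<open>\<real>\<^sub>>\<^sub>0(\<alpha>)\<close> is empty (by Gordan's
  theorem), which yields a nonzero polynomial in \<open>\<theta>\<close> in the annihilator.

  Conversely, a nonzero ideal \<open>I\<close> contains a homogeneous element, and hence a nonzero polynomial in \<open>\<theta>\<close>.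
  If the ideal \<open>I \<inter> \<complex>[\<theta>]\<close> had a common zero \<open>\<alpha>\<close>, then conjugating by operators of degree \<open>\<plusminus>a\<close> shows
  that its elements vanish at \<open>\<alpha> + a\<close> for all \<open>a\<close> deep inside the open cone \<open>\<real>\<^sub>>\<^sub>0(\<alpha>)\<close>, so they would be zero.
  By the Nullstellensatz \<open>1 \<in> I\<close>.\<close>

section \<open>Polynomial functions and the Nullstellensatz\<close>

text \<open>Polynomials are encoded as functions, which loses nothing over the infinite field
  \<complex> and makes translation and evaluation immediate.\<close>

inductive_set polyfun :: "(complex^'n::finite \<Rightarrow> complex) set" where
  const: "(\<lambda>_. c) \<in> polyfun"
| coord: "(\<lambda>x. x $ i) \<in> polyfun"
| add: "p \<in> polyfun \<Longrightarrow> q \<in> polyfun \<Longrightarrow> (\<lambda>x. p x + q x) \<in> polyfun"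
| mult: "p \<in> polyfun \<Longrightarrow> q \<in> polyfun \<Longrightarrow> (\<lambda>x. p x * q x) \<in> polyfun"

lemma polyfun_diff:
  assumes "p \<in> polyfun" "q \<in> polyfun" shows "(\<lambda>x. p x - q x) \<in> polyfun"
  using polyfun.add[OF assms(1) polyfun.mult[OF polyfun.const[of "-1"] assms(2)]] by simp

lemma polyfun_sum:
  assumes "\<And>j. j \<in> B \<Longrightarrow> p j \<in> polyfun" shows "(\<lambda>x. \<Sum>j\<in>B. p j x) \<in> polyfun"
  using assms by (induction B rule: infinite_finite_induct) (auto intro: polyfun.intros)

lemma polyfun_prod:
  assumes "\<And>j. j \<in> B \<Longrightarrow> p j \<in> polyfun" shows "(\<lambda>x. \<Prod>j\<in>B. p j x) \<in> polyfun"
  using assms by (induction B rule: infinite_finite_induct) (auto intro: polyfun.intros)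

lemma polyfun_poly:
  assumes "p \<in> polyfun" shows "(\<lambda>x. poly h (p x)) \<in> polyfun"
  by (induction h) (auto intro!: polyfun.intros assms)

lemma polyfun_translate:
  assumes "p \<in> polyfun" shows "(\<lambda>x. p (x + a)) \<in> polyfun"
  using assms by induction (auto intro: polyfun.intros)

text \<open>Restriction to a line reduces questions of vanishing to the finiteness of the roots of a
  univariate polynomial.\<close>

lemma polyfun_on_line:
  assumes "p \<in> polyfun"
  shows "\<exists>q. \<forall>z. p (x + z *s v) = poly q z"
  using assms
proof induction
  case (const c)
  show ?case by (rule exI[of _ "[:c:]"]) simp
next
  case (coord i)
  show ?case by (rule exI[of _ "[:x $ i, v $ i:]"]) simp
next
  case (add p q)
  then obtain q1 q2 where "\<forall>z. p (x + z *s v) = poly q1 z" "\<forall>z. q (x + z *s v) = poly q2 z"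
    by blast
  then show ?case by (intro exI[of _ "q1 + q2"]) simp
next
  case (mult p q)
  then obtain q1 q2 where "\<forall>z. p (x + z *s v) = poly q1 z" "\<forall>z. q (x + z *s v) = poly q2 z"
    by blast
  then show ?case by (intro exI[of _ "q1 * q2"]) simp
qed

lemma polyfun_zero_on_line:
  assumes "p \<in> polyfun" "\<And>n::nat. n \<ge> K \<Longrightarrow> p (x + of_nat n *s v) = 0"
  shows "p (x + z *s v) = 0"
proof -
  obtain q where q: "\<And>z. p (x + z *s v) = poly q z"
    using polyfun_on_line[OF assms(1)] by blast
  have "of_nat ` {K..} \<subseteq> {z. poly q z = 0}"
    using assms(2) q by auto
  moreover have "infinite (of_nat ` {K..} :: complex set)"
    by (simp add: finite_image_iff inj_on_def infinite_Ici)
  ultimately have "q = 0"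
    using poly_roots_finite finite_subset by metis
  then show ?thesis using q by simp
qed

text \<open>One direction is freed at a time: with the other coefficients fixed, vanishing for all
  large natural coefficients of \<open>v k\<close> gives vanishing for all complex ones. Every
  Zariski density statement below comes from here.\<close>

lemma polyfun_zero_on_lattice_cone:
  fixes v :: "'k \<Rightarrow> complex^'n::finite"
  assumes "p \<in> polyfun" "finite B"
    and "\<And>n::'k \<Rightarrow> nat. (\<forall>j\<in>B. n j \<ge> K) \<Longrightarrow> p (x + (\<Sum>j\<in>B. of_nat (n j) *s v j)) = 0"
  shows "p (x + (\<Sum>j\<in>B. z j *s v j)) = 0"
  using assms(2,3)
proof (induction B arbitrary: x)
  case empty
  then show ?case by simp
next
  case (insert k B)
  have "p (x + (\<Sum>j\<in>B. of_nat (n j) *s v j) + z k *s v k) = 0" if n: "\<forall>j\<in>B. n j \<ge> K" for n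
  proof (rule polyfun_zero_on_line[OF assms(1), of K])
    fix m :: nat assume "m \<ge> K"
    then have "\<forall>j\<in>insert k B. (n(k := m)) j \<ge> K" using n by auto
    from insert.prems[OF this]
    have "p (x + (\<Sum>j\<in>insert k B. of_nat ((n(k := m)) j) *s v j)) = 0" .
    moreover have "(\<Sum>j\<in>insert k B. of_nat ((n(k := m)) j) *s v j)
        = of_nat m *s v k + (\<Sum>j\<in>B. of_nat (n j) *s v j)"
      using insert.hyps by (auto intro!: sum.cong)
    ultimately show "p (x + (\<Sum>j\<in>B. of_nat (n j) *s v j) + of_nat m *s v k) = 0"
      by (simp add: algebra_simps)
  qed
  then have "p ((x + z k *s v k) + (\<Sum>j\<in>B. z j *s v j)) = 0"
    by (intro insert.IH) (simp add: algebra_simps)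
  then show ?case using insert.hyps by (simp add: algebra_simps)
qed

text \<open>The ring is an integral domain: on the line through \<open>x\<close> and
  \<open>y\<close> both factors restrict to nonzero univariate polynomials, as the parameters 0 and
  1 show.\<close>

lemma polyfun_nonzero_mult:
  assumes "p \<in> polyfun" "q \<in> polyfun" "p x \<noteq> 0" "q y \<noteq> 0"
  shows "\<exists>z. p z * q z \<noteq> 0"
proof -
  obtain p1 q1 where p1: "\<And>z. p (x + z *s (y - x)) = poly p1 z"
    and q1: "\<And>z. q (x + z *s (y - x)) = poly q1 z"
    using polyfun_on_line[OF assms(1)] polyfun_on_line[OF assms(2)] by metis
  have "poly p1 0 \<noteq> 0" "poly q1 1 \<noteq> 0" using p1[of 0] q1[of 1] assms by auto
  then have "p1 * q1 \<noteq> 0" by auto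
  then obtain z where "poly (p1 * q1) z \<noteq> 0" using poly_all_0_iff_0 by blast
  then show ?thesis using p1 q1 by (intro exI[of _ "x + z *s (y - x)"]) simp
qed

lemma polyfun_nonzero_prod:
  assumes "finite B" "\<And>j. j \<in> B \<Longrightarrow> p j \<in> polyfun" "\<And>j. j \<in> B \<Longrightarrow> \<exists>x. p j x \<noteq> 0"
  shows "\<exists>x. (\<Prod>j\<in>B. p j x) \<noteq> 0"
  using assms
proof (induction B)
  case (insert k B)
  then obtain x y where "p k x \<noteq> 0" "(\<Prod>j\<in>B. p j y) \<noteq> 0" by (metis insertCI)
  then have "\<exists>z. p k z * (\<Prod>j\<in>B. p j z) \<noteq> 0"
    by (intro polyfun_nonzero_mult[of "p k" "\<lambda>z. \<Prod>j\<in>B. p j z" x y] polyfun_prod) (use insert in auto)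
  with insert show ?case by simp
qed simp

section \<open>Ideals of the polynomial ring and its countable dimension\<close>

definition poly_ideal :: "(complex^'n::finite \<Rightarrow> complex) set \<Rightarrow> bool" where
  "poly_ideal J \<longleftrightarrow> J \<subseteq> polyfun \<and> (\<lambda>_. 0) \<in> J \<and> (\<forall>p\<in>J. \<forall>q\<in>J. (\<lambda>x. p x + q x) \<in> J)
     \<and> (\<forall>p\<in>J. \<forall>q\<in>polyfun. (\<lambda>x. q x * p x) \<in> J)"

lemma poly_ideal_add: "poly_ideal J \<Longrightarrow> p \<in> J \<Longrightarrow> q \<in> J \<Longrightarrow> (\<lambda>x. p x + q x) \<in> J"
  and poly_ideal_mult: "poly_ideal J \<Longrightarrow> p \<in> J \<Longrightarrow> q \<in> polyfun \<Longrightarrow> (\<lambda>x. q x * p x) \<in> J"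
  by (auto simp: poly_ideal_def)

lemma poly_ideal_diff:
  assumes "poly_ideal J" "p \<in> J" "q \<in> J" shows "(\<lambda>x. p x - q x) \<in> J"
  using poly_ideal_add[OF assms(1,2) poly_ideal_mult[OF assms(1,3) polyfun.const[of "-1"]]] by simp

lemma poly_ideal_sum:
  assumes "poly_ideal J" "\<And>j. j \<in> B \<Longrightarrow> p j \<in> J" shows "(\<lambda>x. \<Sum>j\<in>B. p j x) \<in> J"
  using assms(2)
  by (induction B rule: infinite_finite_induct)
    (use assms(1) in \<open>auto simp: poly_ideal_def\<close>)

definition monomials :: "(complex^'n::finite \<Rightarrow> complex) set" where
  "monomials = range (\<lambda>(e::'n \<Rightarrow> nat) x. \<Prod>i\<in>UNIV. x $ i ^ e i)"

lemma monomials_mult: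
  assumes "p \<in> monomials" "q \<in> monomials" shows "(\<lambda>x. p x * q x) \<in> monomials"
proof -
  obtain e f where "p = (\<lambda>x. \<Prod>i\<in>UNIV. x $ i ^ e i)" "q = (\<lambda>x. \<Prod>i\<in>UNIV. x $ i ^ f i)"
    using assms by (auto simp: monomials_def)
  then have "(\<lambda>x. p x * q x) = (\<lambda>x. \<Prod>i\<in>UNIV. x $ i ^ (e i + f i))"
    by (auto simp: prod.distrib power_add)
  then show ?thesis by (auto simp: monomials_def)
qed

text \<open>The Nullstellensatz below plays this countable spanning set off against the
  uncountability of the ground field.\<close>

lemma countable_monomials: "countable monomials"
  by (simp add: monomials_def)

interpretation cfun: vector_space "\<lambda>(c::complex) (f::'a \<Rightarrow> complex) x. c * f x"
  by unfold_locales (auto simp: fun_eq_iff algebra_simps)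

lemma polyfun_in_span_monomials:
  assumes "p \<in> polyfun" shows "p \<in> cfun.span monomials"
  using assms
proof induction
  case (const c)
  have "(\<lambda>_. 1) \<in> monomials" unfolding monomials_def by (rule image_eqI[of _ _ "\<lambda>_. 0"]) auto
  from cfun.span_scale[OF cfun.span_base[OF this], of c] show ?case by simp
next
  case (coord i)
  have "(\<lambda>x. x $ i) = (\<lambda>x. \<Prod>j\<in>UNIV. x $ j ^ (if j = i then 1 else 0))"
    by (rule ext) (subst prod.mono_neutral_right[of UNIV "{i}"]; simp)
  then have "(\<lambda>x. x $ i) \<in> monomials" unfolding monomials_def by (rule image_eqI[where x = "\<lambda>j. if j = i then 1 else 0"]) simp
  then show ?case by (rule cfun.span_base)
next
  case (add p q)
  then show ?case using cfun.span_add[of p _ q] by (simp add: plus_fun_def)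
next
  case (mult p q)
  \<comment> \<open>Closure of monomials under products is extended bilinearly: first in
    \<open>p\<close> against a fixed monomial, then in \<open>q\<close>.\<close>
  have m: "(\<lambda>x. p x * r x) \<in> cfun.span monomials" if r: "r \<in> monomials" for r
    using mult.IH(1)
  proof (induction rule: cfun.span_induct_alt)
    case base
    show ?case using cfun.span_zero[of monomials] by (simp add: zero_fun_def)
  next
    case (step c s t)
    have "(\<lambda>x. c * (s x * r x)) \<in> cfun.span monomials"
      by (intro cfun.span_scale[of "\<lambda>x. s x * r x"] cfun.span_base monomials_mult step r)
    from cfun.span_add[OF this step(2)] show ?case
      by (simp add: plus_fun_def algebra_simps)
  qed
  show ?case using mult.IH(2)
  proof (induction rule: cfun.span_induct_alt)
    case base
    show ?case using cfun.span_zero[of monomials] by (simp add: zero_fun_def)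
  next
    case (step c s t)
    from cfun.span_add[OF cfun.span_scale[OF m[OF step(1)], of c] step(2)] show ?case
      by (simp add: plus_fun_def algebra_simps)
  qed
qed

text \<open>If every \<open>x\<^sub>i - c\<close> is invertible modulo \<open>J\<close>, then so is every nonzero polynomial in \<open>x\<^sub>i\<close>,
  because it splits into linear factors.\<close>

lemma one_mem_poly_ideal_if_poly_mem:
  assumes J: "poly_ideal J"
    and g: "\<And>c. g c \<in> polyfun" "\<And>c. (\<lambda>x. 1 - g c x * (x $ i - c)) \<in> J"
    and "h \<noteq> 0" "(\<lambda>x. poly h (x $ i)) \<in> J"
  shows "(\<lambda>_. 1) \<in> J"
  using assms(4,5)
proof (induction "degree h" arbitrary: h)
  case 0
  then obtain c where c: "h = [:c:]" "c \<noteq> 0" by (metis degree_0_id pCons_eq_0_iff)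
  with poly_ideal_mult[OF J 0(3) polyfun.const[of "1 / c"]] show ?case by simp
next
  case (Suc n)
  then obtain e where "poly h e = 0"
    using fundamental_theorem_of_algebra[of h] constant_degree[of h] by auto
  then obtain k where k: "h = [:-e, 1:] * k" by (auto simp: poly_eq_0_iff_dvd)
  then have "k \<noteq> 0" using Suc.prems by auto
  then have "degree h = Suc (degree k)"
    unfolding k by (subst degree_mult_eq) auto
  moreover have "(\<lambda>x. poly k (x $ i)) \<in> J"
  proof -
    \<comment> \<open>Since \<open>g e\<close> inverts the linear factor modulo \<open>J\<close>,
      that factor can be divided out of \<open>h\<close>; this combination equals
      \<open>k\<close>.\<close>
    have "(\<lambda>x. poly k (x $ i) * (1 - g e x * (x $ i - e)) + g e x * poly h (x $ i)) \<in> J"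
      by (intro poly_ideal_add[OF J] poly_ideal_mult[OF J] g Suc.prems polyfun_poly polyfun.coord)
    then show ?thesis by (simp add: k algebra_simps)
  qed
  ultimately show ?case using Suc.hyps \<open>k \<noteq> 0\<close> by auto
qed

text \<open>Otherwise the inverses \<open>g\<^sub>c\<close> of \<open>x\<^sub>i - c\<close> modulo \<open>J\<close> form an uncountable family in a space of
  countable dimension; clearing denominators in a linear relation among them gives a nonzero
  polynomial in \<open>x\<^sub>i\<close> lying in \<open>J\<close>.\<close>

lemma coord_eigenvalue_mod_poly_ideal:
  fixes J :: "(complex^'n::finite \<Rightarrow> complex) set"
  assumes J: "poly_ideal J" and proper: "(\<lambda>_. 1) \<notin> J"
  shows "\<exists>c. \<forall>q\<in>polyfun. (\<lambda>x. 1 - q x * (x $ i - c)) \<notin> J"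
proof (rule ccontr)
  assume "\<not> ?thesis"
  then obtain g where g: "\<And>c. g c \<in> polyfun" "\<And>c. (\<lambda>x. 1 - g c x * (x $ i - c)) \<in> J"
    by metis
  \<comment> \<open>Distinct values cannot share an inverse: subtracting the two relations would put
    \<open>g c\<close>, and then 1, into \<open>J\<close>.\<close>
  have inj: "inj g"
  proof (rule injI, rule ccontr)
    fix c d assume eq: "g c = g d" and ne: "c \<noteq> d"
    have "(\<lambda>x. g c x * (c - d)) \<in> J"
      using poly_ideal_diff[OF J g(2)[of c] g(2)[of d]] by (simp add: eq algebra_simps)
    from poly_ideal_mult[OF J this polyfun.const[of "1 / (c - d)"]]
    have "g c \<in> J" using ne by simp
    then have "(\<lambda>x. (x $ i - c) * g c x) \<in> J"
      by (rule poly_ideal_mult[OF J]) (intro polyfun_diff polyfun.intros)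
    from poly_ideal_add[OF J this g(2)[of c]] have "(\<lambda>_. 1) \<in> J" by (simp add: mult.commute)
    with proper show False by simp
  qed
  \<comment> \<open>Each \<open>g c\<close> lies in the span of one of these countably many finite
    sets, so uncountably many real parameters share one finite-dimensional span.\<close>
  let ?Fin = "{B. B \<subseteq> (monomials :: (complex^'n \<Rightarrow> complex) set) \<and> finite B}"
  have "countable ?Fin"
    using countable_Collect_finite_subset[OF countable_monomials] by (simp add: conj_commute)
  moreover have "UNIV \<subseteq> (\<Union>B\<in>?Fin. {r. g (complex_of_real r) \<in> cfun.span B})"
  proof
    fix r :: real
    have "g (of_real r) \<in> cfun.span monomials"
      using g(1) by (rule polyfun_in_span_monomials)
    then obtain t u where t: "finite t" "t \<subseteq> monomials"
      "g (of_real r) = (\<Sum>a\<in>t. (\<lambda>x. u a * a x))"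
      unfolding cfun.span_explicit by blast
    have "g (of_real r) \<in> cfun.span t"
      unfolding t(3) by (intro cfun.span_sum cfun.span_scale cfun.span_base)
    with t show "r \<in> (\<Union>B\<in>?Fin. {r. g (complex_of_real r) \<in> cfun.span B})" by blast
  qed
  ultimately have "\<exists>B\<in>?Fin. uncountable {r. g (complex_of_real r) \<in> cfun.span B}"
    by (metis (no_types, lifting) countable_UN countable_subset uncountable_UNIV_real)
  then obtain B where B: "finite B" "uncountable {r. g (complex_of_real r) \<in> cfun.span B}"
    by blast
  define X where "X = complex_of_real ` {r. g (complex_of_real r) \<in> cfun.span B}"
  have "infinite X"
    using B(2) countable_finite unfolding X_def by (auto simp: finite_image_iff inj_on_def)
  then have "infinite (g ` X)" using inj_on_subset[OF inj subset_UNIV] by (simp add: finite_image_iff)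
  moreover have "g ` X \<subseteq> cfun.span B" by (auto simp: X_def)
  ultimately have "cfun.dependent (g ` X)" using cfun.independent_span_bound[OF B(1)] by blast
  then obtain T u v where T: "finite T" "T \<subseteq> g ` X" "(\<Sum>v\<in>T. (\<lambda>x. u v * v x)) = 0"
    and v: "v \<in> T" "u v \<noteq> 0"
    unfolding cfun.dependent_explicit by blast
  obtain C where C: "T = g ` C" using T(2) by (meson subset_imageE)
  have injC: "inj_on g C" using inj by (rule inj_on_subset) simp
  have finC: "finite C" using T(1) C injC by (simp add: finite_image_iff)
  obtain c0 where c0: "c0 \<in> C" "v = g c0" using v C by auto
  have rel: "(\<Sum>c\<in>C. u (g c) * g c x) = 0" for x
  proof -
    have "(\<Sum>v\<in>T. (\<lambda>x. u v * v x)) x = 0" using T(3) by simp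
    moreover have "(\<Sum>v\<in>T. (\<lambda>x. u v * v x)) x = (\<Sum>v\<in>T. u v * v x)"
      using T(1) by induction simp_all
    ultimately show ?thesis by (simp add: C sum.reindex[OF injC])
  qed
  \<comment> \<open>The numerator obtained by multiplying the relation by all x_i - d and replacing
    \<open>g c\<close> times x_i - c by 1. At \<open>c0\<close> only the summand of
    \<open>c0\<close> survives.\<close>
  define h where "h = (\<Sum>c\<in>C. smult (u (g c)) (\<Prod>d\<in>C - {c}. [:-d, 1:]))"
  have h: "poly h z = (\<Sum>c\<in>C. u (g c) * (\<Prod>d\<in>C - {c}. z - d))" for z
    by (simp add: h_def poly_sum poly_prod)
  have "poly h c0 = (\<Sum>c\<in>{c0}. u (g c) * (\<Prod>d\<in>C - {c}. c0 - d))"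
    unfolding h by (rule sum.mono_neutral_right) (use finC c0 in \<open>auto intro!: prod_zero\<close>)
  also have "\<dots> \<noteq> 0" using v c0 finC by auto
  finally have "h \<noteq> 0" by auto
  moreover have "(\<lambda>x. poly h (x $ i)) \<in> J"
  proof -
    have "(\<lambda>x. \<Sum>c\<in>C. (u (g c) * (\<Prod>d\<in>C - {c}. x $ i - d)) * (1 - g c x * (x $ i - c))) \<in> J"
      by (intro poly_ideal_sum[OF J] poly_ideal_mult[OF J] g polyfun.intros polyfun_prod polyfun_diff)
    moreover have "(\<Sum>c\<in>C. (u (g c) * (\<Prod>d\<in>C - {c}. x $ i - d)) * (1 - g c x * (x $ i - c)))
        = poly h (x $ i)" for x
    proof -
      have "(u (g c) * (\<Prod>d\<in>C - {c}. x $ i - d)) * (1 - g c x * (x $ i - c))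
        = u (g c) * (\<Prod>d\<in>C - {c}. x $ i - d) - (\<Prod>d\<in>C. x $ i - d) * (u (g c) * g c x)" if "c \<in> C" for c
        unfolding prod.remove[OF finC that, of "\<lambda>d. x $ i - d"] by (simp add: algebra_simps)
      then have "(\<Sum>c\<in>C. (u (g c) * (\<Prod>d\<in>C - {c}. x $ i - d)) * (1 - g c x * (x $ i - c)))
        = poly h (x $ i) - (\<Prod>d\<in>C. x $ i - d) * (\<Sum>c\<in>C. u (g c) * g c x)"
        by (simp add: h sum_subtractf sum_distrib_left)
      then show ?thesis by (simp add: rel)
    qed
    ultimately show ?thesis by simp
  qed
  ultimately have "(\<lambda>_. 1) \<in> J" using one_mem_poly_ideal_if_poly_mem[OF J g] by blast
  with proper show False by simp
qed

text \<open>With \<open>c\<close> chosen so that x_i - c is not invertible modulo \<open>J\<close>,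
  the ideal generated by \<open>J\<close> and x_i - c cannot contain 1.\<close>

lemma proper_poly_ideal_extend:
  fixes J :: "(complex^'n::finite \<Rightarrow> complex) set"
  assumes J: "poly_ideal J" and proper: "(\<lambda>_. 1) \<notin> J"
  shows "\<exists>c J'. poly_ideal J' \<and> J \<subseteq> J' \<and> (\<lambda>_. 1) \<notin> J' \<and> (\<lambda>x. x $ i - c) \<in> J'"
proof -
  obtain c where c: "\<And>q. q \<in> polyfun \<Longrightarrow> (\<lambda>x. 1 - q x * (x $ i - c)) \<notin> J"
    using coord_eigenvalue_mod_poly_ideal[OF assms] by blast
  define J' where "J' = {\<lambda>x. p x + q x * (x $ i - c) | p q. p \<in> J \<and> q \<in> polyfun}"
  have J': "\<And>p q. p \<in> J \<Longrightarrow> q \<in> polyfun \<Longrightarrow> (\<lambda>x. p x + q x * (x $ i - c)) \<in> J'"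
    by (auto simp: J'_def)
  have zero: "(\<lambda>_. 0) \<in> J" and sub: "J \<subseteq> polyfun" using J by (auto simp: poly_ideal_def)
  have incl: "J \<subseteq> J'"
    using J'[OF _ polyfun.const[of 0]] by auto
  have "poly_ideal J'"
    unfolding poly_ideal_def
  proof (intro conjI ballI)
    show "J' \<subseteq> polyfun"
      unfolding J'_def using sub by (auto intro!: polyfun.add polyfun.mult polyfun_diff polyfun.coord polyfun.const)
    show "(\<lambda>_. 0) \<in> J'" using zero incl by blast
  next
    fix p q assume "p \<in> J'" "q \<in> J'"
    then obtain p1 p2 q1 q2 where
      p: "p = (\<lambda>x. p1 x + p2 x * (x $ i - c))" "p1 \<in> J" "p2 \<in> polyfun" and
      q: "q = (\<lambda>x. q1 x + q2 x * (x $ i - c))" "q1 \<in> J" "q2 \<in> polyfun"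
      unfolding J'_def by blast
    have "(\<lambda>x. (p1 x + q1 x) + (p2 x + q2 x) * (x $ i - c)) \<in> J'"
      by (intro J' poly_ideal_add[OF J] polyfun.add p q)
    then show "(\<lambda>x. p x + q x) \<in> J'" by (simp add: p(1) q(1) algebra_simps)
  next
    fix p q :: "complex^'n \<Rightarrow> complex" assume "p \<in> J'" and q: "q \<in> polyfun"
    then obtain p1 p2 where p: "p = (\<lambda>x. p1 x + p2 x * (x $ i - c))" "p1 \<in> J" "p2 \<in> polyfun"
      unfolding J'_def by blast
    have "(\<lambda>x. (q x * p1 x) + (q x * p2 x) * (x $ i - c)) \<in> J'"
      by (intro J' poly_ideal_mult[OF J] polyfun.mult p q)
    then show "(\<lambda>x. q x * p x) \<in> J'" by (simp add: p(1) algebra_simps)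
  qed
  moreover have "(\<lambda>_. 1) \<notin> J'"
  proof
    assume "(\<lambda>_. 1) \<in> J'"
    then obtain p q where pq: "(\<lambda>_. 1) = (\<lambda>x. p x + q x * (x $ i - c))" "p \<in> J" "q \<in> polyfun"
      unfolding J'_def by blast
    have "p = (\<lambda>x. 1 - q x * (x $ i - c))"
      using fun_cong[OF pq(1)] by (auto simp: algebra_simps)
    with c pq show False by blast
  qed
  moreover have "(\<lambda>x. x $ i - c) \<in> J'" using J'[OF zero polyfun.const[of 1]] by simp
  ultimately show ?thesis using incl by blast
qed

text \<open>Adjoining some x_i - c_i for every coordinate in turn keeps the ideal proper, and modulo
  it each polynomial is congruent to its value at \<alpha> = (c_i). An element of \<open>J\<close>
  not vanishing at \<alpha> would therefore put a nonzero constant into the ideal.\<close>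

theorem weak_nullstellensatz:
  fixes J :: "(complex^'n::finite \<Rightarrow> complex) set"
  assumes J: "poly_ideal J" and proper: "(\<lambda>_. 1) \<notin> J"
  shows "\<exists>\<alpha>. \<forall>p\<in>J. p \<alpha> = 0"
proof -
  have "\<exists>J'. poly_ideal J' \<and> J \<subseteq> J' \<and> (\<lambda>_. 1) \<notin> J' \<and> (\<forall>i\<in>T. \<exists>c. (\<lambda>x. x $ i - c) \<in> J')"
    if "finite T" for T :: "'n set"
    using that
  proof (induction T)
    case empty
    then show ?case using assms by blast
  next
    case (insert i T)
    then obtain J' where J': "poly_ideal J'" "J \<subseteq> J'" "(\<lambda>_. 1) \<notin> J'" "\<forall>i\<in>T. \<exists>c. (\<lambda>x. x $ i - c) \<in> J'"
      by blast
    obtain c J'' where J'': "poly_ideal J''" "J' \<subseteq> J''" "(\<lambda>_. 1) \<notin> J''" "(\<lambda>x. x $ i - c) \<in> J''"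
      using proper_poly_ideal_extend[OF J'(1,3)] by blast
    have "\<forall>j\<in>insert i T. \<exists>c. (\<lambda>x. x $ j - c) \<in> J''"
      using J'(4) J''(2,4) by blast
    with J'' J'(2) show ?case by (meson subset_trans)
  qed
  from this[OF finite_class.finite_UNIV] obtain J' c where J': "poly_ideal J'" "J \<subseteq> J'" "(\<lambda>_. 1) \<notin> J'"
    and c: "\<And>i. (\<lambda>x. x $ i - c i) \<in> J'"
    by (metis UNIV_I)
  define \<alpha> where "\<alpha> = (\<chi> i. c i)"
  have mod: "(\<lambda>x. p x - p \<alpha>) \<in> J'" if "p \<in> polyfun" for p
    using that
  proof induction
    case (const c)
    then show ?case using J' by (simp add: poly_ideal_def)
  next
    case (coord i)
    then show ?case using c by (simp add: \<alpha>_def)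
  next
    case (add p q)
    from poly_ideal_add[OF J'(1) add.IH] show ?case by (simp add: algebra_simps)
  next
    case (mult p q)
    have "(\<lambda>x. q x * (p x - p \<alpha>) + p \<alpha> * (q x - q \<alpha>)) \<in> J'"
      by (intro poly_ideal_add[OF J'(1)] poly_ideal_mult[OF J'(1)] mult polyfun.const)
    then show ?case by (simp add: algebra_simps)
  qed
  have "p \<alpha> = 0" if p: "p \<in> J" for p
  proof (rule ccontr)
    assume ne: "p \<alpha> \<noteq> 0"
    have "p \<in> polyfun" using p J by (auto simp: poly_ideal_def)
    from poly_ideal_diff[OF J'(1) _ mod[OF this], of p] p J' have "(\<lambda>_. p \<alpha>) \<in> J'" by auto
    from poly_ideal_mult[OF J'(1) this polyfun.const[of "1 / p \<alpha>"]] ne J'(3) show False by simp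
  qed
  then show ?thesis by blast
qed

section \<open>Symbols of differential operators\<close>

definition cv :: "int^'n \<Rightarrow> complex^'n" where
  "cv b = (\<chi> i. of_int (b $ i))"

lemma cv_nth [simp]: "cv b $ i = of_int (b $ i)" by (simp add: cv_def)

lemma cv_add: "cv (a + b) = cv a + cv b"
  and cv_0 [simp]: "cv 0 = 0"
  by (simp_all add: vec_eq_iff)

text \<open>Zariski density of the lattice, which makes the symbol of an operator unique.\<close>

lemma polyfun_eq_if_eq_on_lattice:
  fixes p q :: "complex^'n::finite \<Rightarrow> complex"
  assumes "p \<in> polyfun" "q \<in> polyfun" "\<And>b. p (cv b) = q (cv b)"
  shows "p = q"
proof
  fix x :: "complex^'n"
  have "(\<lambda>x. p x - q x) (0 + (\<Sum>i\<in>UNIV. x $ i *s axis i 1)) = 0"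
  proof (rule polyfun_zero_on_lattice_cone)
    show "(\<lambda>x. p x - q x) \<in> polyfun" using assms by (intro polyfun_diff)
  next
    fix n :: "'n \<Rightarrow> nat"
    have "0 + (\<Sum>i\<in>UNIV. of_nat (n i) *s axis i 1) = cv (\<chi> i. int (n i))"
      by (subst basis_expansion[symmetric, of "cv (\<chi> i. int (n i))"]) simp
    then show "p (0 + (\<Sum>i\<in>UNIV. of_nat (n i) *s axis i 1)) - q (0 + (\<Sum>i\<in>UNIV. of_nat (n i) *s axis i 1)) = 0"
      using assms(3) by simp
  qed simp
  then show "p x = q x" by (simp add: basis_expansion)
qed

text \<open>\<open>f\<close> is the family of coefficients in \<open>P = (\<Sum>a. t\<^sup>a f\<^sub>a(\<theta>))\<close>, where
  \<open>\<theta>\<^sub>i = t\<^sub>i \<partial>\<^sub>i\<close> acts on \<open>t\<^sup>b\<close> as multiplication by \<open>b\<^sub>i\<close>.\<close>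

definition has_symbol ::
    "('n::finite laurent \<Rightarrow> 'n laurent) \<Rightarrow> (int^'n \<Rightarrow> complex^'n \<Rightarrow> complex) \<Rightarrow> bool" where
  "has_symbol P f \<longleftrightarrow> (\<forall>a. f a \<in> polyfun) \<and> finite {a. f a \<noteq> (\<lambda>_. 0)} \<and>
     (\<forall>g c. Poly_Mapping.lookup (P g) c
        = (\<Sum>b\<in>Poly_Mapping.keys g. f (c - b) (cv b) * Poly_Mapping.lookup g b))"

text \<open>The operator t^a p(\<theta>), which sends t^b to p(b) t^(a+b).\<close>

definition homop :: "int^'n \<Rightarrow> (complex^'n \<Rightarrow> complex) \<Rightarrow> 'n::finite laurent \<Rightarrow> 'n laurent" where
  "homop a p g = (\<Sum>b\<in>Poly_Mapping.keys g. Poly_Mapping.single (a + b) (p (cv b) * Poly_Mapping.lookup g b))"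

lemma has_symbol_polyfun: "has_symbol P f \<Longrightarrow> f a \<in> polyfun"
  and has_symbol_finite: "has_symbol P f \<Longrightarrow> finite {a. f a \<noteq> (\<lambda>_. 0)}"
  and has_symbol_lookup: "has_symbol P f \<Longrightarrow> Poly_Mapping.lookup (P g) c
        = (\<Sum>b\<in>Poly_Mapping.keys g. f (c - b) (cv b) * Poly_Mapping.lookup g b)"
  by (auto simp: has_symbol_def)

lemma has_symbol_lookup_superset:
  assumes "has_symbol P f" "finite X" "Poly_Mapping.keys g \<subseteq> X"
  shows "Poly_Mapping.lookup (P g) c = (\<Sum>b\<in>X. f (c - b) (cv b) * Poly_Mapping.lookup g b)"
  unfolding has_symbol_lookup[OF assms(1)]
  by (rule sum.mono_neutral_left) (use assms in \<open>auto simp: in_keys_iff\<close>)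

lemma has_symbol_lookup_single:
  assumes "has_symbol P f"
  shows "Poly_Mapping.lookup (P (Poly_Mapping.single b 1)) c = f (c - b) (cv b)"
  by (simp add: has_symbol_lookup[OF assms])

lemma has_symbol_unique:
  assumes "has_symbol P f" "has_symbol P h" shows "f = h"
proof
  fix a
  have "f a (cv b) = h a (cv b)" for b
    using has_symbol_lookup_single[OF assms(1), of b "a + b"]
      has_symbol_lookup_single[OF assms(2), of b "a + b"] by simp
  then show "f a = h a"
    using assms by (intro polyfun_eq_if_eq_on_lattice has_symbol_polyfun)
qed

lemma has_symbol_inj:
  assumes "has_symbol P f" "has_symbol Q f" shows "P = Q"
  by (intro ext poly_mapping_eqI)
    (simp add: has_symbol_lookup[OF assms(1)] has_symbol_lookup[OF assms(2)])

lemma has_symbol_homop: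
  assumes "p \<in> polyfun"
  shows "has_symbol (homop a p) (\<lambda>d. if d = a then p else (\<lambda>_. 0))"
  unfolding has_symbol_def
proof (intro conjI allI)
  show "finite {d. (if d = a then p else (\<lambda>_. 0)) \<noteq> (\<lambda>_. 0)}"
    by (rule finite_subset[of _ "{a}"]) auto
next
  fix g c
  show "Poly_Mapping.lookup (homop a p g) c = (\<Sum>b\<in>Poly_Mapping.keys g.
      (if c - b = a then p else (\<lambda>_. 0)) (cv b) * Poly_Mapping.lookup g b)"
    unfolding homop_def lookup_sum lookup_single
    by (rule sum.cong) (auto simp: when_def)
qed (auto intro: assms polyfun.const)

lemma has_symbol_add:
  assumes "has_symbol P f" "has_symbol Q h"
  shows "has_symbol (\<lambda>g. P g + Q g) (\<lambda>a x. f a x + h a x)"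
  unfolding has_symbol_def
proof (intro conjI allI)
  show "finite {a. (\<lambda>x. f a x + h a x) \<noteq> (\<lambda>_. 0)}"
    by (rule finite_subset[OF _ finite_UnI[OF has_symbol_finite[OF assms(1)] has_symbol_finite[OF assms(2)]]])
      auto
qed (use assms in \<open>auto intro: polyfun.add dest: has_symbol_polyfun
      simp: lookup_add has_symbol_lookup sum.distrib algebra_simps\<close>)

lemma has_symbol_diff:
  assumes "has_symbol P f" "has_symbol Q h"
  shows "has_symbol (\<lambda>g. P g - Q g) (\<lambda>a x. f a x - h a x)"
  unfolding has_symbol_def
proof (intro conjI allI)
  show "finite {a. (\<lambda>x. f a x - h a x) \<noteq> (\<lambda>_. 0)}"
    by (rule finite_subset[OF _ finite_UnI[OF has_symbol_finite[OF assms(1)] has_symbol_finite[OF assms(2)]]])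
      auto
qed (use assms in \<open>auto intro: polyfun_diff dest: has_symbol_polyfun
      simp: lookup_minus has_symbol_lookup sum_subtractf algebra_simps\<close>)

text \<open>Moving f(\<theta>) past t^a turns it into f(\<theta> + a), so symbols multiply by a
  convolution with translated left factor. The set \<open>S\<close> may be any finite set containing
  the support of \<open>h\<close>, which allows singletons for homogeneous operators.\<close>

lemma has_symbol_comp:
  fixes P Q :: "'n::finite laurent \<Rightarrow> 'n laurent"
  assumes P: "has_symbol P f" and Q: "has_symbol Q h"
    and S: "finite S" "\<And>a. a \<notin> S \<Longrightarrow> h a = (\<lambda>_. 0)"
  shows "has_symbol (P \<circ> Q) (\<lambda>d x. \<Sum>a\<in>S. f (d - a) (x + cv a) * h a x)"
  unfolding has_symbol_def
proof (intro conjI allI)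
  fix a
  show "(\<lambda>x. \<Sum>aa\<in>S. f (a - aa) (x + cv aa) * h aa x) \<in> polyfun"
    using P Q by (intro polyfun_sum polyfun.mult polyfun_translate has_symbol_polyfun)
next
  let ?X = "(\<lambda>(a, b). a + b) ` ({a. f a \<noteq> (\<lambda>_. 0)} \<times> S)"
  have "{d. (\<lambda>x. \<Sum>a\<in>S. f (d - a) (x + cv a) * h a x) \<noteq> (\<lambda>_. 0)} \<subseteq> ?X"
  proof (rule subsetI, rule ccontr)
    fix d assume d: "d \<in> {d. (\<lambda>x. \<Sum>a\<in>S. f (d - a) (x + cv a) * h a x) \<noteq> (\<lambda>_. 0)}" and n: "d \<notin> ?X"
    have "f (d - a) = (\<lambda>_. 0)" if "a \<in> S" for a
    proof (rule ccontr)
      assume "f (d - a) \<noteq> (\<lambda>_. 0)"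
      then have "(d - a) + a \<in> ?X" using that by force
      with n show False by simp
    qed
    with d show False by simp
  qed
  then show "finite {d. (\<lambda>x. \<Sum>a\<in>S. f (d - a) (x + cv a) * h a x) \<noteq> (\<lambda>_. 0)}"
    by (rule finite_subset) (use S has_symbol_finite[OF P] in auto)
next
  fix g :: "'n laurent" and c
  \<comment> \<open>A finite set containing every degree that \<open>Q\<close> reaches from
    \<open>g\<close>. With this index set independent of \<open>b\<close>, the two sums can be
    swapped.\<close>
  let ?X = "(\<lambda>(a, b). a + b) ` (S \<times> Poly_Mapping.keys g)"
  have in_X: "e \<in> ?X" if "b \<in> Poly_Mapping.keys g" "e - b \<in> S" for b e
  proof -
    have "(e - b) + b \<in> ?X" using that by force
    then show ?thesis by simp
  qed
  have X: "Poly_Mapping.keys (Q g) \<subseteq> ?X"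
  proof
    fix e assume "e \<in> Poly_Mapping.keys (Q g)"
    then have "(\<Sum>b\<in>Poly_Mapping.keys g. h (e - b) (cv b) * Poly_Mapping.lookup g b) \<noteq> 0"
      unfolding in_keys_iff has_symbol_lookup[OF Q] .
    then obtain b where b: "b \<in> Poly_Mapping.keys g" "h (e - b) (cv b) \<noteq> 0"
      by (metis (no_types, lifting) mult_eq_0_iff sum.neutral)
    then have "e - b \<in> S" using S(2) by metis
    with b(1) show "e \<in> ?X" by (rule in_X)
  qed
  have fin: "finite ?X" using S by simp
  have "Poly_Mapping.lookup ((P \<circ> Q) g) c
      = (\<Sum>e\<in>?X. f (c - e) (cv e) * Poly_Mapping.lookup (Q g) e)"
    using has_symbol_lookup_superset[OF P fin X] by simp
  also have "\<dots> = (\<Sum>e\<in>?X. \<Sum>b\<in>Poly_Mapping.keys g.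
      f (c - e) (cv e) * h (e - b) (cv b) * Poly_Mapping.lookup g b)"
    by (simp add: has_symbol_lookup[OF Q] sum_distrib_left mult.assoc)
  also have "\<dots> = (\<Sum>b\<in>Poly_Mapping.keys g. \<Sum>e\<in>?X.
      f (c - e) (cv e) * h (e - b) (cv b) * Poly_Mapping.lookup g b)"
    by (rule sum.swap)
  also have "\<dots> = (\<Sum>b\<in>Poly_Mapping.keys g.
      (\<Sum>a\<in>S. f (c - b - a) (cv b + cv a) * h a (cv b)) * Poly_Mapping.lookup g b)"
  proof (rule sum.cong[OF refl])
    fix b assume b: "b \<in> Poly_Mapping.keys g"
    have "(\<Sum>e\<in>?X. f (c - e) (cv e) * h (e - b) (cv b) * Poly_Mapping.lookup g b)
       = (\<Sum>e\<in>(\<lambda>a. a + b) ` S. f (c - e) (cv e) * h (e - b) (cv b) * Poly_Mapping.lookup g b)"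
    proof (rule sum.mono_neutral_right[OF fin])
      show "(\<lambda>a. a + b) ` S \<subseteq> ?X" using b by auto
      show "\<forall>e\<in>?X - (\<lambda>a. a + b) ` S. f (c - e) (cv e) * h (e - b) (cv b) * Poly_Mapping.lookup g b = 0"
      proof
        fix e assume e: "e \<in> ?X - (\<lambda>a. a + b) ` S"
        have "e - b \<notin> S"
        proof
          assume "e - b \<in> S"
          then have "(e - b) + b \<in> (\<lambda>a. a + b) ` S" by blast
          with e show False by simp
        qed
        then show "f (c - e) (cv e) * h (e - b) (cv b) * Poly_Mapping.lookup g b = 0"
          using S(2) by simp
      qed
    qed
    also have "\<dots> = (\<Sum>a\<in>S. f (c - (a + b)) (cv (a + b)) * h a (cv b) * Poly_Mapping.lookup g b)"
      by (subst sum.reindex) (auto simp: inj_on_def)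
    also have "\<dots> = (\<Sum>a\<in>S. f (c - b - a) (cv b + cv a) * h a (cv b)) * Poly_Mapping.lookup g b"
      by (simp add: sum_distrib_right cv_add diff_diff_eq add.commute)
    finally show "(\<Sum>e\<in>?X. f (c - e) (cv e) * h (e - b) (cv b) * Poly_Mapping.lookup g b) = \<dots>" .
  qed
  finally show "Poly_Mapping.lookup ((P \<circ> Q) g) c = (\<Sum>b\<in>Poly_Mapping.keys g.
      (\<Sum>a\<in>S. f (c - b - a) (cv b + cv a) * h a (cv b)) * Poly_Mapping.lookup g b)" .
qed

section \<open>Homogeneous operators inside the Weyl algebra\<close>

lemma sum_lookup_single:
  "(\<Sum>b\<in>Poly_Mapping.keys f. Poly_Mapping.single b (Poly_Mapping.lookup f b)) = f"
  by (rule poly_mapping_eqI)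
    (auto simp: lookup_sum lookup_single when_def sum.delta in_keys_iff)

lemma mult_eq_homop:
  "(\<lambda>f. Poly_Mapping.single a c * f) = (homop a (\<lambda>_. c) :: 'n::finite laurent \<Rightarrow> 'n laurent)"
proof
  fix f :: "'n laurent"
  have "Poly_Mapping.single a c * f
      = Poly_Mapping.single a c * (\<Sum>b\<in>Poly_Mapping.keys f. Poly_Mapping.single b (Poly_Mapping.lookup f b))"
    by (simp add: sum_lookup_single)
  then show "Poly_Mapping.single a c * f = homop a (\<lambda>_. c) f"
    by (simp add: homop_def sum_distrib_left mult_single)
qed

lemma pd_eq_homop: "pd i = homop (- axis i 1) (\<lambda>x. x $ i)"
  by (auto simp: pd_def homop_def fun_eq_iff)

lemma homop_comp:
  assumes "p \<in> polyfun" "q \<in> polyfun"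
  shows "homop a p \<circ> homop b q = homop (a + b) (\<lambda>x. p (x + cv b) * q x)"
proof -
  let ?s = "\<lambda>a p d. if d = a then p else (\<lambda>_. 0 :: complex)"
  have "has_symbol (homop a p \<circ> homop b q)
      (\<lambda>d x. \<Sum>e\<in>{b}. ?s a p (d - e) (x + cv e) * ?s b q e x)"
    by (rule has_symbol_comp[OF has_symbol_homop has_symbol_homop]) (use assms in auto)
  moreover have "(\<lambda>d x. \<Sum>e\<in>{b}. ?s a p (d - e) (x + cv e) * ?s b q e x)
      = ?s (a + b) (\<lambda>x. p (x + cv b) * q x)"
    by (auto simp: fun_eq_iff)
  moreover have "has_symbol (homop (a + b) (\<lambda>x. p (x + cv b) * q x))
      (?s (a + b) (\<lambda>x. p (x + cv b) * q x))"
    by (intro has_symbol_homop polyfun.mult polyfun_translate assms)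
  ultimately show ?thesis by (intro has_symbol_inj) (simp_all only:)
qed

text \<open>The products t_i \<partial>_i = \<theta>_i supply the coordinates in degree 0; a
  monomial on the left then shifts to degree \<open>a\<close>.\<close>

lemma homop_in_weyl_ops:
  assumes "p \<in> polyfun" shows "homop a p \<in> weyl_ops"
proof -
  have mult: "homop a (\<lambda>_. c) \<in> weyl_ops" for a :: "int^'n" and c
    by (metis mult_eq_homop weyl_ops.mult)
  have "homop 0 p \<in> weyl_ops"
    using assms
  proof induction
    case (const c)
    show ?case by (rule mult)
  next
    case (coord i)
    have "homop (axis i 1) (\<lambda>_. 1) \<circ> pd i \<in> weyl_ops"
      by (intro weyl_ops.comp mult weyl_ops.deriv)
    then show ?case by (simp add: pd_eq_homop homop_comp polyfun.const polyfun.coord)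
  next
    case (add p q)
    have "homop 0 (\<lambda>x. p x + q x) = (\<lambda>g. homop 0 p g + homop 0 q g)"
      by (auto simp: homop_def fun_eq_iff sum.distrib[symmetric] single_add algebra_simps)
    then show ?case using weyl_ops.add[OF add.IH] by simp
  next
    case (mult p q)
    from weyl_ops.comp[OF mult.IH] show ?case using mult.hyps by (simp add: homop_comp)
  qed
  from weyl_ops.comp[OF mult[of a 1] this] show ?thesis
    by (simp add: homop_comp assms polyfun.const)
qed

lemma weyl_ops_has_symbol:
  assumes "P \<in> weyl_ops" shows "\<exists>f. has_symbol P f"
  using assms
proof induction
  case (mult a c)
  show ?case unfolding mult_eq_homop using has_symbol_homop polyfun.const by blast
next
  case (deriv i)
  show ?case unfolding pd_eq_homop using has_symbol_homop polyfun.coord by blast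
next
  case (add P Q)
  then show ?case using has_symbol_add by blast
next
  case (comp P Q)
  then obtain f h where fh: "has_symbol P f" "has_symbol Q h" by blast
  from has_symbol_comp[OF fh has_symbol_finite[OF fh(2)]] show ?case by blast
qed

definition symbol :: "('n::finite laurent \<Rightarrow> 'n laurent) \<Rightarrow> int^'n \<Rightarrow> complex^'n \<Rightarrow> complex" where
  "symbol P = (THE f. has_symbol P f)"

lemma symbol_eq: "has_symbol P f \<Longrightarrow> symbol P = f"
  unfolding symbol_def using has_symbol_unique by (intro the_equality) auto

lemma has_symbol_symbol: "P \<in> weyl_ops \<Longrightarrow> has_symbol P (symbol P)"
  using weyl_ops_has_symbol symbol_eq by metis

lemma symbol_polyfun: "P \<in> weyl_ops \<Longrightarrow> symbol P a \<in> polyfun"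
  and symbol_finite: "P \<in> weyl_ops \<Longrightarrow> finite {a. symbol P a \<noteq> (\<lambda>_. 0)}"
  using has_symbol_symbol has_symbol_polyfun has_symbol_finite by blast+

lemma symbol_homop: "p \<in> polyfun \<Longrightarrow> symbol (homop a p) = (\<lambda>d. if d = a then p else (\<lambda>_. 0))"
  by (rule symbol_eq[OF has_symbol_homop])

lemma symbol_diff:
  "P \<in> weyl_ops \<Longrightarrow> Q \<in> weyl_ops \<Longrightarrow> symbol (\<lambda>g. P g - Q g) = (\<lambda>a x. symbol P a x - symbol Q a x)"
  by (intro symbol_eq has_symbol_diff has_symbol_symbol)

lemma symbol_comp:
  "P \<in> weyl_ops \<Longrightarrow> Q \<in> weyl_ops \<Longrightarrow> symbol (P \<circ> Q)
    = (\<lambda>d x. \<Sum>a | symbol Q a \<noteq> (\<lambda>_. 0). symbol P (d - a) (x + cv a) * symbol Q a x)"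
  by (intro symbol_eq has_symbol_comp has_symbol_symbol symbol_finite) auto

lemma weyl_ops_diff:
  fixes P Q :: "'n::finite laurent \<Rightarrow> 'n laurent"
  assumes "P \<in> weyl_ops" "Q \<in> weyl_ops" shows "(\<lambda>g. P g - Q g) \<in> weyl_ops"
proof -
  have "(\<lambda>g. P g + (homop 0 (\<lambda>_. -1) \<circ> Q) g) \<in> weyl_ops"
    by (intro weyl_ops.add weyl_ops.comp assms homop_in_weyl_ops polyfun.const)
  moreover have "homop 0 (\<lambda>_. -1) g = - g" for g :: "'n laurent"
    unfolding mult_eq_homop[symmetric, THEN fun_cong]
    by (simp add: single_uminus)
  ultimately show ?thesis by simp
qed

lemma homop_zero: "homop a (\<lambda>_. 0) = (\<lambda>_. 0)"
  by (simp add: homop_def fun_eq_iff)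

lemma homop_one: "homop 0 (\<lambda>_. 1) = (\<lambda>g. g)"
  by (simp add: homop_def fun_eq_iff sum_lookup_single)

lemma symbol_zero_iff:
  fixes P :: "'n::finite laurent \<Rightarrow> 'n laurent"
  assumes "P \<in> weyl_ops" shows "(\<forall>a. symbol P a = (\<lambda>_. 0)) \<longleftrightarrow> P = (\<lambda>_. 0)"
proof
  assume "\<forall>a. symbol P a = (\<lambda>_. 0)"
  then show "P = (\<lambda>_. 0)"
    by (auto intro!: poly_mapping_eqI simp: fun_eq_iff has_symbol_lookup[OF has_symbol_symbol[OF assms]])
next
  assume "P = (\<lambda>_. 0)"
  then show "\<forall>a. symbol P a = (\<lambda>_. 0)"
    using symbol_homop[OF polyfun.const, of "0 :: int^'n" 0] by (auto simp: homop_zero)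
qed

text \<open>It suffices to test \<open>P\<close> on monomials t^b. The supports are kept general
  because \<nat>A and its scored closure both occur later.\<close>

lemma weyl_ops_maps_iff:
  assumes "P \<in> weyl_ops"
  shows "(\<forall>g. Poly_Mapping.keys g \<subseteq> X \<longrightarrow> Poly_Mapping.keys (P g) \<subseteq> Y)
    \<longleftrightarrow> (\<forall>b\<in>X. \<forall>a. b + a \<notin> Y \<longrightarrow> symbol P a (cv b) = 0)" (is "?L \<longleftrightarrow> ?R")
proof
  assume L: ?L
  show ?R
  proof (intro ballI allI impI)
    fix a b assume b: "b \<in> X" and "b + a \<notin> Y"
    have "Poly_Mapping.keys (Poly_Mapping.single b (1::complex)) \<subseteq> X" using b by simp
    with L have "b + a \<notin> Poly_Mapping.keys (P (Poly_Mapping.single b 1))" using \<open>b + a \<notin> Y\<close> by blast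
    then show "symbol P a (cv b) = 0"
      by (simp add: in_keys_iff has_symbol_lookup_single[OF has_symbol_symbol[OF assms]])
  qed
next
  assume R: ?R
  show ?L
  proof (intro allI impI subsetI, rule ccontr)
    fix g c assume g: "Poly_Mapping.keys g \<subseteq> X" and c: "c \<in> Poly_Mapping.keys (P g)" "c \<notin> Y"
    have "symbol P (c - b) (cv b) = 0" if "b \<in> Poly_Mapping.keys g" for b
      using R g that c(2) by (metis add_diff_cancel_left' diff_add_cancel subsetD)
    then have "Poly_Mapping.lookup (P g) c = 0"
      by (simp add: has_symbol_lookup[OF has_symbol_symbol[OF assms]])
    with c(1) show False by (simp add: in_keys_iff)
  qed
qed

section \<open>The algebra D(R_A) and its two-sided ideals\<close>

lemma D_R_iff:
  "P \<in> D_R A \<longleftrightarrow> P \<in> weyl_ops \<and> (\<forall>b\<in>NA A. \<forall>a. b + a \<notin> NA A \<longrightarrow> symbol P a (cv b) = 0)"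
  using weyl_ops_maps_iff[of P "NA A" "NA A"] by (auto simp: D_R_def R_A_def)

lemma D_R_weyl_ops: "P \<in> D_R A \<Longrightarrow> P \<in> weyl_ops"
  by (simp add: D_R_def)

lemma homop_in_D_R_iff:
  "p \<in> polyfun \<Longrightarrow> homop a p \<in> D_R A \<longleftrightarrow> (\<forall>b\<in>NA A. b + a \<notin> NA A \<longrightarrow> p (cv b) = 0)"
  by (auto simp: D_R_iff symbol_homop homop_in_weyl_ops)

lemma homop_0_in_D_R: "p \<in> polyfun \<Longrightarrow> homop 0 p \<in> D_R A"
  by (simp add: homop_in_D_R_iff)

lemma D_R_comp: "P \<in> D_R A \<Longrightarrow> Q \<in> D_R A \<Longrightarrow> P \<circ> Q \<in> D_R A"
  by (auto simp: D_R_def intro: weyl_ops.comp)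

lemma D_R_diff: "P \<in> D_R A \<Longrightarrow> Q \<in> D_R A \<Longrightarrow> (\<lambda>g. P g - Q g) \<in> D_R A"
  by (auto simp: D_R_iff weyl_ops_diff symbol_diff)

lemma ideal_comp_left: "two_sided_ideal D I \<Longrightarrow> P \<in> D \<Longrightarrow> Q \<in> I \<Longrightarrow> P \<circ> Q \<in> I"
  and ideal_comp_right: "two_sided_ideal D I \<Longrightarrow> P \<in> D \<Longrightarrow> Q \<in> I \<Longrightarrow> Q \<circ> P \<in> I"
  and ideal_diff: "two_sided_ideal D I \<Longrightarrow> P \<in> I \<Longrightarrow> Q \<in> I \<Longrightarrow> (\<lambda>f. P f - Q f) \<in> I"
  and ideal_subset: "two_sided_ideal D I \<Longrightarrow> Q \<in> I \<Longrightarrow> Q \<in> D"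
  by (auto simp: two_sided_ideal_def)

text \<open>An element of minimal support is homogeneous: \<open>[\<theta>\<^sub>i, P] - a\<^sub>i P\<close> multiplies the component of
  degree \<open>c\<close> of \<open>P\<close> by \<open>c\<^sub>i - a\<^sub>i\<close>.\<close>

lemma ideal_contains_homop:
  fixes A :: "(int^'n::finite) set"
  assumes I: "two_sided_ideal (D_R A) I" and ne: "I \<noteq> {\<lambda>_. 0}"
  shows "\<exists>a p. p \<in> polyfun \<and> p \<noteq> (\<lambda>_. 0) \<and> homop a p \<in> I"
proof -
  let ?supp = "\<lambda>P. {a. symbol P a \<noteq> (\<lambda>_. 0)}"
  have weyl: "P \<in> weyl_ops" if "P \<in> I" for P
    using ideal_subset[OF I that] by (rule D_R_weyl_ops)
  obtain P0 where "P0 \<in> I" "P0 \<noteq> (\<lambda>_. 0)"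
    using ne I unfolding two_sided_ideal_def by blast
  then obtain P where P: "P \<in> I" "P \<noteq> (\<lambda>_. 0)"
    and min: "\<And>Q. Q \<in> I \<Longrightarrow> Q \<noteq> (\<lambda>_. 0) \<Longrightarrow> card (?supp P) \<le> card (?supp Q)"
    using ex_has_least_nat[of "\<lambda>P. P \<in> I \<and> P \<noteq> (\<lambda>_. 0)" P0 "\<lambda>P. card (?supp P)"] by blast
  note Pw = weyl[OF P(1)]
  obtain a where a: "symbol P a \<noteq> (\<lambda>_. 0)" using symbol_zero_iff[OF Pw] P by blast
  have single: "symbol P c = (\<lambda>_. 0)" if "c \<noteq> a" for c
  proof (rule ccontr)
    assume c: "symbol P c \<noteq> (\<lambda>_. 0)"
    obtain i where i: "c $ i \<noteq> a $ i" using \<open>c \<noteq> a\<close> by (auto simp: vec_eq_iff)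
    define \<theta> where "\<theta> = homop 0 (\<lambda>x::complex^'n. x $ i)"
    define \<kappa> where "\<kappa> = homop 0 (\<lambda>_::complex^'n. of_int (a $ i))"
    have D: "\<theta> \<in> D_R A" "\<kappa> \<in> D_R A"
      unfolding \<theta>_def \<kappa>_def by (intro homop_0_in_D_R polyfun.intros)+
    define Q where "Q = (\<lambda>g. ((\<theta> \<circ> P) g - (P \<circ> \<theta>) g) - (\<kappa> \<circ> P) g)"
    have "Q \<in> I"
      unfolding Q_def by (intro ideal_diff[OF I] ideal_comp_left[OF I] ideal_comp_right[OF I] D P)
    have fin: "finite (?supp P)" using Pw by (rule symbol_finite)
    have \<theta>: "has_symbol \<theta> (\<lambda>d. if d = 0 then (\<lambda>x. x $ i) else (\<lambda>_. 0))"
      and \<kappa>: "has_symbol \<kappa> (\<lambda>d. if d = 0 then (\<lambda>_. of_int (a $ i)) else (\<lambda>_. 0))"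
      unfolding \<theta>_def \<kappa>_def by (intro has_symbol_homop polyfun.intros)+
    have left: "(\<Sum>e\<in>?supp P. (if d - e = 0 then q else (\<lambda>_. 0)) (x + cv e) * symbol P e x)
        = q (x + cv d) * symbol P d x" for d x and q :: "complex^'n \<Rightarrow> complex"
    proof (cases "d \<in> ?supp P")
      case True
      then show ?thesis using fin by (subst sum.remove[of _ d]) (auto intro!: sum.neutral)
    qed (auto intro!: sum.neutral)
    have "has_symbol (\<theta> \<circ> P) (\<lambda>d x. (x + cv d) $ i * symbol P d x)"
      using has_symbol_comp[OF \<theta> has_symbol_symbol[OF Pw] fin] unfolding left by simp
    moreover have "has_symbol (P \<circ> \<theta>) (\<lambda>d x. symbol P d x * x $ i)"
      using has_symbol_comp[OF has_symbol_symbol[OF Pw] \<theta>, of "{0}"] by simp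
    moreover have "has_symbol (\<kappa> \<circ> P) (\<lambda>d x. of_int (a $ i) * symbol P d x)"
      using has_symbol_comp[OF \<kappa> has_symbol_symbol[OF Pw] fin] unfolding left by simp
    ultimately have "has_symbol Q (\<lambda>d x. ((x + cv d) $ i * symbol P d x - symbol P d x * x $ i)
        - of_int (a $ i) * symbol P d x)"
      unfolding Q_def by (intro has_symbol_diff)
    then have sQ: "symbol Q = (\<lambda>d x. of_int (d $ i - a $ i) * symbol P d x)"
      using symbol_eq by (simp add: algebra_simps)
    have "?supp Q \<subseteq> ?supp P - {a}" by (auto simp: sQ)
    then have "card (?supp Q) < card (?supp P)"
      using a fin by (intro psubset_card_mono) auto
    moreover have "symbol Q c \<noteq> (\<lambda>_. 0)" using c i by (auto simp: sQ fun_eq_iff)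
    then have "Q \<noteq> (\<lambda>_. 0)" using symbol_zero_iff[OF weyl[OF \<open>Q \<in> I\<close>]] by blast
    ultimately show False using min \<open>Q \<in> I\<close> by fastforce
  qed
  have "symbol P = (\<lambda>d. if d = a then symbol P a else (\<lambda>_. 0))"
    using single by auto
  then have "P = homop a (symbol P a)"
    using has_symbol_inj has_symbol_symbol[OF Pw] has_symbol_homop[OF symbol_polyfun[OF Pw]] by metis
  with P(1) a symbol_polyfun[OF Pw] show ?thesis by metis
qed

section \<open>Facets, primitive forms and the conductor\<close>

lemma lat_pt_nth [simp]: "lat_pt a $ i = of_int (a $ i)" by (simp add: lat_pt_def)

lemma lat_pt_add: "lat_pt (a + b) = lat_pt a + lat_pt b"
  and lat_pt_diff: "lat_pt (a - b) = lat_pt a - lat_pt b"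
  and lat_pt_0 [simp]: "lat_pt 0 = 0"
  and lat_pt_scale: "lat_pt (k *s a) = of_int k *\<^sub>R lat_pt a"
  by (simp_all add: vec_eq_iff)

lemma lat_pt_sum: "lat_pt (\<Sum>a\<in>B. f a) = (\<Sum>a\<in>B. lat_pt (f a))"
  by (induction B rule: infinite_finite_induct) (simp_all add: lat_pt_add)

lemma inj_lat_pt: "inj lat_pt"
  by (auto simp: inj_def vec_eq_iff)

lemma finite_bounded_lattice: "finite {z::int^'n::finite. norm (lat_pt z) \<le> r}"
proof -
  have "z \<in> (\<lambda>f. \<chi> i. f i) ` (UNIV \<rightarrow>\<^sub>E {-\<lceil>r\<rceil>..\<lceil>r\<rceil>})" if z: "norm (lat_pt z) \<le> r" for z :: "int^'n"
  proof (rule image_eqI)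
    show "z = (\<chi> i. (\<lambda>i. z $ i) i)" by simp
    have "z $ i \<in> {-\<lceil>r\<rceil>..\<lceil>r\<rceil>}" for i
    proof -
      have "\<bar>real_of_int (z $ i)\<bar> \<le> r"
        using component_le_norm_cart[of "lat_pt z" i] z by simp
      then show ?thesis by (auto simp: abs_le_iff) linarith+
    qed
    then show "(\<lambda>i. z $ i) \<in> UNIV \<rightarrow>\<^sub>E {-\<lceil>r\<rceil>..\<lceil>r\<rceil>}" by auto
  qed
  then have "{z::int^'n. norm (lat_pt z) \<le> r} \<subseteq> (\<lambda>f. \<chi> i. f i) ` (UNIV \<rightarrow>\<^sub>E {-\<lceil>r\<rceil>..\<lceil>r\<rceil>})" by blast
  then show ?thesis by (rule finite_subset) (simp add: finite_PiE)
qed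

text \<open>The bound depends on \<open>B\<close> alone: up to integral combinations of
  \<open>B\<close>, only finitely many lattice points in its span remain.\<close>

lemma norm_fractional_part_le:
  fixes B :: "(int^'n::finite) set"
  assumes "lat_pt z = (\<Sum>b\<in>B. c b *\<^sub>R lat_pt b)"
  shows "norm (lat_pt (z - (\<Sum>b\<in>B. \<lfloor>c b\<rfloor> *s b))) \<le> (\<Sum>b\<in>B. norm (lat_pt b))"
proof -
  have "lat_pt (z - (\<Sum>b\<in>B. \<lfloor>c b\<rfloor> *s b)) = (\<Sum>b\<in>B. frac (c b) *\<^sub>R lat_pt b)"
    by (simp add: lat_pt_diff lat_pt_sum lat_pt_scale assms frac_def scaleR_diff_left sum_subtractf)
  also have "norm \<dots> \<le> (\<Sum>b\<in>B. norm (frac (c b) *\<^sub>R lat_pt b))" by (rule norm_sum)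
  also have "\<dots> \<le> (\<Sum>b\<in>B. norm (lat_pt b))"
  proof (rule sum_mono)
    fix b
    show "norm (frac (c b) *\<^sub>R lat_pt b) \<le> norm (lat_pt b)"
      using frac_ge_0[of "c b"] frac_lt_1[of "c b"] by (simp add: mult_left_le_one_le)
  qed
  finally show ?thesis .
qed

text \<open>The generator is the least element of \<open>G\<close> in (0,1]; the remainder of any
  element modulo it is smaller, hence 0.\<close>

lemma discrete_real_subgroup:
  fixes G :: "real set"
  assumes one: "1 \<in> G" and diff: "\<And>x y. x \<in> G \<Longrightarrow> y \<in> G \<Longrightarrow> x - y \<in> G"
    and fin: "finite (G \<inter> {0..1})"
  shows "\<exists>g>0. G = range (\<lambda>m::int. of_int m * g)"
proof -
  have zero: "0 \<in> G" using diff[OF one one] by simp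
  have uminus: "- x \<in> G" if "x \<in> G" for x using diff[OF zero that] by simp
  have add: "x + y \<in> G" if "x \<in> G" "y \<in> G" for x y using diff[OF that(1) uminus[OF that(2)]] by simp
  have nat: "of_nat m * x \<in> G" if "x \<in> G" for m x
    by (induction m) (auto simp: zero algebra_simps intro: add that)
  have int: "of_int m * x \<in> G" if "x \<in> G" for m x
    using nat[OF that] uminus[OF nat[OF that]] by (cases m rule: int_cases2) auto
  define g where "g = Min (G \<inter> {0<..1})"
  have fin': "finite (G \<inter> {0<..1})" by (rule finite_subset[OF _ fin]) auto
  have "g \<in> G \<inter> {0<..1}" unfolding g_def by (rule Min_in[OF fin']) (use one in auto)
  then have g: "g \<in> G" "0 < g" "g \<le> 1" by auto
  have min: "g \<le> x" if "x \<in> G" "0 < x" for x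
  proof (cases "x \<le> 1")
    case True
    then show ?thesis unfolding g_def using that by (intro Min_le fin') auto
  qed (use g in auto)
  have "x \<in> range (\<lambda>m::int. of_int m * g)" if "x \<in> G" for x
  proof -
    have "x - of_int \<lfloor>x / g\<rfloor> * g \<in> G" using that int g by (intro diff)
    moreover have "0 \<le> x - of_int \<lfloor>x / g\<rfloor> * g" "x - of_int \<lfloor>x / g\<rfloor> * g < g"
      using floor_divide_lower[OF g(2), of x] floor_divide_upper[OF g(2), of x]
      by (simp_all add: algebra_simps)
    ultimately have "x - of_int \<lfloor>x / g\<rfloor> * g = 0" using min by force
    then show ?thesis by auto
  qed
  then have "G = range (\<lambda>m::int. of_int m * g)" using int g by blast
  with g show ?thesis by blast
qed

section \<open>The monoid and its cone\<close>

locale lattice_gens =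
  fixes A :: "(int^'n::finite) set"
  assumes finite_A: "finite A" and int_span_A: "int_span A = UNIV"
begin

lemma lattice_combination: "\<exists>k. z = (\<Sum>a\<in>A. k a *s a)"
  using int_span_A by (auto simp: int_span_def vector_scalar_mult_def)

lemma NA_iff: "z \<in> NA A \<longleftrightarrow> (\<exists>k. (\<forall>a\<in>A. 0 \<le> k a) \<and> z = (\<Sum>a\<in>A. k a *s a))"
proof
  assume "z \<in> NA A"
  then obtain k where "z = (\<Sum>a\<in>A. (\<chi> i. int (k a) * a $ i))" by (auto simp: NA_def)
  then show "\<exists>k. (\<forall>a\<in>A. 0 \<le> k a) \<and> z = (\<Sum>a\<in>A. k a *s a)"
    by (intro exI[of _ "\<lambda>a. int (k a)"]) (simp add: vector_scalar_mult_def)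
next
  assume "\<exists>k. (\<forall>a\<in>A. 0 \<le> k a) \<and> z = (\<Sum>a\<in>A. k a *s a)"
  then obtain k where k: "\<forall>a\<in>A. 0 \<le> k a" "z = (\<Sum>a\<in>A. k a *s a)" by blast
  have "(\<Sum>a\<in>A. k a *s a) = (\<Sum>a\<in>A. (\<chi> i. int (nat (k a)) * a $ i))"
    using k by (intro sum.cong) (auto simp: vector_scalar_mult_def)
  with k show "z \<in> NA A"
    unfolding NA_def by (intro CollectI exI[of _ "\<lambda>a. nat (k a)"]) simp
qed

lemma NA_0: "0 \<in> NA A"
  unfolding NA_iff by (intro exI[of _ "\<lambda>_. 0"]) simp

lemma NA_add: assumes "x \<in> NA A" "y \<in> NA A" shows "x + y \<in> NA A"
proof -
  from assms obtain k l where "\<forall>a\<in>A. 0 \<le> k a" "x = (\<Sum>a\<in>A. k a *s a)"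
    "\<forall>a\<in>A. 0 \<le> l a" "y = (\<Sum>a\<in>A. l a *s a)" unfolding NA_iff by blast
  then show ?thesis unfolding NA_iff
    by (intro exI[of _ "\<lambda>a. k a + l a"]) (simp add: sum.distrib vector_sadd_rdistrib)
qed

lemma NA_scale: assumes "0 \<le> c" "x \<in> NA A" shows "c *s x \<in> NA A"
proof -
  from assms obtain k where "\<forall>a\<in>A. 0 \<le> k a" "x = (\<Sum>a\<in>A. k a *s a)" unfolding NA_iff by blast
  then show ?thesis unfolding NA_iff using assms
    by (intro exI[of _ "\<lambda>a. c * k a"])
      (simp add: vec_eq_iff sum_distrib_left mult.assoc)
qed

lemma A_subset_NA: assumes "a \<in> A" shows "a \<in> NA A"
  unfolding NA_iff using assms finite_A
  by (intro exI[of _ "\<lambda>b. if b = a then 1 else 0"]) (simp add: if_distrib[of "\<lambda>c. c *s _"] sum.delta cong: if_cong)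

lemma NA_sum: assumes "\<And>j. j \<in> B \<Longrightarrow> f j \<in> NA A" shows "(\<Sum>j\<in>B. f j) \<in> NA A"
  using assms by (induction B rule: infinite_finite_induct) (auto intro: NA_0 NA_add)

lemma convex_cone_cone_A: "convex_cone (cone_A A)"
  unfolding convex_cone_iff
proof (intro conjI ballI allI impI)
  show "0 \<in> cone_A A" unfolding cone_A_def by (intro CollectI exI[of _ "\<lambda>_. 0"]) simp
next
  fix x y assume "x \<in> cone_A A" "y \<in> cone_A A"
  then obtain c d where "\<forall>a\<in>A. 0 \<le> c a" "x = (\<Sum>a\<in>A. c a *\<^sub>R lat_pt a)"
    "\<forall>a\<in>A. 0 \<le> d a" "y = (\<Sum>a\<in>A. d a *\<^sub>R lat_pt a)" unfolding cone_A_def by blast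
  then show "x + y \<in> cone_A A" unfolding cone_A_def
    by (intro CollectI exI[of _ "\<lambda>a. c a + d a"]) (simp add: sum.distrib scaleR_add_left)
next
  fix x and r :: real assume "x \<in> cone_A A" "0 \<le> r"
  then obtain c where "\<forall>a\<in>A. 0 \<le> c a" "x = (\<Sum>a\<in>A. c a *\<^sub>R lat_pt a)" unfolding cone_A_def by blast
  then show "r *\<^sub>R x \<in> cone_A A" unfolding cone_A_def using \<open>0 \<le> r\<close>
    by (intro CollectI exI[of _ "\<lambda>a. r * c a"]) (simp add: scaleR_sum_right)
qed

lemma lat_pt_in_cone: assumes "a \<in> A" shows "lat_pt a \<in> cone_A A"
  unfolding cone_A_def using assms finite_A
  by (intro CollectI exI[of _ "\<lambda>b. if b = a then 1 else 0"])
    (simp add: if_distrib[of "\<lambda>c. c *\<^sub>R _"] sum.delta cong: if_cong)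

text \<open>Opens the way to Minkowski-Weyl: a finitely generated cone is a polyhedron, hence has
  finitely many facets.\<close>

lemma cone_A_eq_hull: "cone_A A = convex_cone hull (lat_pt ` A)"
proof
  have "(\<Sum>a\<in>B. c a *\<^sub>R lat_pt a) \<in> convex_cone hull (lat_pt ` A)"
    if "\<forall>a\<in>A. 0 \<le> c a" "B \<subseteq> A" for B c
  proof -
    have "finite B" using that(2) finite_A by (rule finite_subset)
    then show ?thesis using that(2)
    proof (induction B)
      case empty
      show ?case by (simp add: convex_cone_hull_contains_0)
    next
      case (insert x B)
      then have "c x *\<^sub>R lat_pt x \<in> convex_cone hull (lat_pt ` A)"
        using that(1) by (intro convex_cone_hull_mul hull_inc) auto
      with insert show ?case by (simp add: convex_cone_hull_add)
    qed
  qed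
  then show "cone_A A \<subseteq> convex_cone hull (lat_pt ` A)" by (auto simp: cone_A_def)
  show "convex_cone hull (lat_pt ` A) \<subseteq> cone_A A"
    by (rule hull_minimal) (auto intro: lat_pt_in_cone convex_cone_cone_A)
qed

lemma polyhedron_cone_A: "polyhedron (cone_A A)"
  unfolding cone_A_eq_hull by (rule polyhedron_convex_cone_hull) (simp add: finite_A)

lemma finite_facets: "finite (facets A)"
  unfolding facets_def by (rule finite_polyhedron_facets[OF polyhedron_cone_A])

lemma span_lat_pt_A: "span (lat_pt ` A) = UNIV"
proof -
  have "x \<in> span (lat_pt ` A)" for x :: "real^'n"
  proof -
    have "lat_pt z \<in> span (lat_pt ` A)" for z
    proof -
      obtain k where k: "z = (\<Sum>a\<in>A. k a *s a)" using lattice_combination by blast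
      show ?thesis unfolding k lat_pt_sum lat_pt_scale
        by (intro span_sum span_scale span_base) auto
    qed
    then have "(\<Sum>i\<in>UNIV. (x $ i) *\<^sub>R lat_pt (axis i 1)) \<in> span (lat_pt ` A)"
      by (intro span_sum span_scale)
    moreover have "(\<Sum>i\<in>UNIV. (x $ i) *\<^sub>R lat_pt (axis i 1)) = x"
      by (simp add: vec_eq_iff axis_def if_distrib[of real_of_int] if_distrib[of "\<lambda>y. _ * y"] sum.delta cong: if_cong)
    ultimately show ?thesis by simp
  qed
  then show ?thesis by blast
qed

lemma zero_in_cone: "0 \<in> cone_A A"
  using convex_cone_contains_0[OF convex_cone_cone_A] .

lemma cone_A_scale: "x \<in> cone_A A \<Longrightarrow> 0 \<le> c \<Longrightarrow> c *\<^sub>R x \<in> cone_A A"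
  using convex_cone_scaleR[OF convex_cone_cone_A] by blast

lemma affine_hull_cone_A: "affine hull (cone_A A) = UNIV"
proof -
  have "span (lat_pt ` A) \<subseteq> span (cone_A A)"
    by (rule span_mono) (auto intro: lat_pt_in_cone)
  then show ?thesis
    using span_lat_pt_A affine_hull_span_0[OF hull_inc[OF zero_in_cone]] by auto
qed

lemma interior_cone_A_nonempty: "interior (cone_A A) \<noteq> {}"
  using rel_interior_eq_empty[of "cone_A A"] convex_cone_cone_A zero_in_cone
    rel_interior_interior[OF affine_hull_cone_A] by (auto simp: convex_cone_def)

section \<open>Facets and their primitive forms\<close>

text \<open>Faces of a polyhedron are exposed. The supporting hyperplane passes through the origin
  because the cone contains 0 and is stable under doubling; its normal is nonzero because a facet is
  a proper face.\<close>

lemma facet_normal: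
  assumes \<sigma>: "\<sigma> \<in> facets A"
  shows "\<exists>w. w \<noteq> 0 \<and> (\<forall>x\<in>cone_A A. 0 \<le> w \<bullet> x) \<and> \<sigma> = cone_A A \<inter> {x. w \<bullet> x = 0}"
proof -
  have facet: "\<sigma> facet_of cone_A A" using \<sigma> by (simp add: facets_def)
  then have "\<sigma> exposed_face_of cone_A A"
    using exposed_face_of_polyhedron[OF polyhedron_cone_A] facet_of_imp_face_of by blast
  then obtain u b where u: "cone_A A \<subseteq> {x. u \<bullet> x \<le> b}" "\<sigma> = cone_A A \<inter> {x. u \<bullet> x = b}"
    by (auto simp: exposed_face_of_def)
  obtain x where x: "x \<in> \<sigma>" using facet by (auto simp: facet_of_def)
  have "0 \<le> b" using u(1) zero_in_cone by auto
  moreover have "u \<bullet> (2 *\<^sub>R x) \<le> b" using u x cone_A_scale[of x 2] by auto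
  ultimately have b: "b = 0" using x u(2) by auto
  have "u \<noteq> 0"
  proof
    assume "u = 0"
    with u b have "\<sigma> = cone_A A" by auto
    with facet show False by simp
  qed
  with u b show ?thesis by (intro exI[of _ "- u"]) auto
qed

text \<open>A nonnegative combination of generators on which \<open>w\<close> vanishes involves only
  generators killed by \<open>w\<close>, so these span \<sigma>; as a facet has codimension 1, they
  span the whole hyperplane.\<close>

lemma span_face_generators:
  assumes \<sigma>: "\<sigma> \<in> facets A" and w: "w \<noteq> 0" "\<And>x. x \<in> cone_A A \<Longrightarrow> 0 \<le> w \<bullet> x"
    and eq: "\<sigma> = cone_A A \<inter> {x. w \<bullet> x = 0}"
  shows "span (lat_pt ` {a\<in>A. w \<bullet> lat_pt a = 0}) = {x. w \<bullet> x = 0}"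
proof (rule subspace_dim_equal)
  let ?B = "{a\<in>A. w \<bullet> lat_pt a = 0}"
  show "subspace {x. w \<bullet> x = 0}" by (rule subspace_hyperplane)
  show "span (lat_pt ` ?B) \<subseteq> {x. w \<bullet> x = 0}"
    by (rule span_minimal) (auto intro: subspace_hyperplane)
  have "\<sigma> \<subseteq> span (lat_pt ` ?B)"
  proof
    fix x assume x: "x \<in> \<sigma>"
    then obtain c where c: "\<forall>a\<in>A. 0 \<le> c a" "x = (\<Sum>a\<in>A. c a *\<^sub>R lat_pt a)"
      by (auto simp: eq cone_A_def)
    have "(\<Sum>a\<in>A. c a * (w \<bullet> lat_pt a)) = 0"
      using x by (simp add: eq c inner_sum_right)
    then have z: "\<forall>a\<in>A. c a * (w \<bullet> lat_pt a) = 0"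
      using c(1) w(2) lat_pt_in_cone finite_A by (subst (asm) sum_nonneg_eq_0_iff) auto
    have "x = (\<Sum>a\<in>?B. c a *\<^sub>R lat_pt a)"
      unfolding c(2) by (rule sum.mono_neutral_right) (use z finite_A in auto)
    moreover have "(\<Sum>a\<in>?B. c a *\<^sub>R lat_pt a) \<in> span (lat_pt ` ?B)"
      by (intro span_sum span_scale span_base) simp
    ultimately show "x \<in> span (lat_pt ` ?B)" by simp
  qed
  then have "dim \<sigma> \<le> dim (span (lat_pt ` ?B))" by (rule dim_subset)
  moreover have "int (dim \<sigma>) = aff_dim \<sigma>"
    by (rule aff_dim_zero[symmetric]) (use zero_in_cone in \<open>auto simp: eq intro!: hull_inc\<close>)
  moreover have "aff_dim \<sigma> = aff_dim (cone_A A) - 1"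
    using \<sigma> by (simp add: facets_def facet_of_def)
  moreover have "aff_dim (cone_A A) = DIM(real^'n)"
    using affine_hull_cone_A by (simp only: aff_dim_eq_full)
  moreover have "dim {x. w \<bullet> x = 0} = DIM(real^'n) - 1" using w(1) by (rule dim_hyperplane)
  ultimately show "dim {x. w \<bullet> x = 0} \<le> dim (span (lat_pt ` ?B))"
    by linarith
qed simp

lemma ex_generator_pos:
  assumes w: "w \<noteq> 0" "\<And>x. x \<in> cone_A A \<Longrightarrow> 0 \<le> w \<bullet> x"
  shows "\<exists>a\<in>A. 0 < w \<bullet> lat_pt a"
proof (rule ccontr)
  assume "\<not> ?thesis"
  then have "\<forall>a\<in>A. w \<bullet> lat_pt a = 0" using w(2) lat_pt_in_cone by (metis order_le_less)
  then have "span (lat_pt ` A) \<subseteq> {x. w \<bullet> x = 0}"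
    by (intro span_minimal) (auto intro: subspace_hyperplane)
  then have "w \<bullet> w = 0" using span_lat_pt_A by blast
  with w show False by simp
qed

text \<open>Scale a normal to be 1 on some generator. Together with the generators in the facet this
  generator spans the space, and \<open>w\<close> is integral on all of them, so modulo \<int> it
  takes only finitely many values on the lattice. These values thus form a discrete group, and
  dividing by its generator \<open>g\<close> turns it into \<int>.\<close>

lemma ex_primitive_form:
  assumes \<sigma>: "\<sigma> \<in> facets A"
  shows "\<exists>w. w \<noteq> 0 \<and> (\<forall>x\<in>cone_A A. 0 \<le> w \<bullet> x) \<and> \<sigma> = cone_A A \<inter> {x. w \<bullet> x = 0}
    \<and> range (\<lambda>z. w \<bullet> lat_pt z) = \<int>"
proof -
  obtain w0 where w0: "w0 \<noteq> 0" "\<forall>x\<in>cone_A A. 0 \<le> w0 \<bullet> x" "\<sigma> = cone_A A \<inter> {x. w0 \<bullet> x = 0}"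
    using facet_normal[OF \<sigma>] by blast
  obtain a0 where a0: "a0 \<in> A" "0 < w0 \<bullet> lat_pt a0"
    using ex_generator_pos[of w0] w0 by blast
  define w where "w = (1 / (w0 \<bullet> lat_pt a0)) *\<^sub>R w0"
  have w: "w \<noteq> 0" "\<forall>x\<in>cone_A A. 0 \<le> w \<bullet> x" "\<sigma> = cone_A A \<inter> {x. w \<bullet> x = 0}" "w \<bullet> lat_pt a0 = 1"
    using w0 a0 by (auto simp: w_def)
  define B where "B = insert a0 {a\<in>A. w \<bullet> lat_pt a = 0}"
  have finB: "finite B" using finite_A by (simp add: B_def)
  have spanB: "\<exists>c. x = (\<Sum>b\<in>B. c b *\<^sub>R lat_pt b)" for x
  proof -
    have "x - (w \<bullet> x) *\<^sub>R lat_pt a0 \<in> {x. w \<bullet> x = 0}"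
      using w(4) by (simp add: inner_diff_right)
    also have "\<dots> = span (lat_pt ` {a\<in>A. w \<bullet> lat_pt a = 0})"
      using span_face_generators[OF \<sigma> w(1) _ w(3)] w(2) by blast
    also have "\<dots> \<subseteq> span (lat_pt ` B)" by (rule span_mono) (auto simp: B_def)
    finally have "x - (w \<bullet> x) *\<^sub>R lat_pt a0 + (w \<bullet> x) *\<^sub>R lat_pt a0 \<in> span (lat_pt ` B)"
      by (rule span_add) (intro span_scale span_base, simp add: B_def)
    then have "x \<in> span (lat_pt ` B)" by simp
    then obtain c where "x = (\<Sum>v\<in>lat_pt ` B. c v *\<^sub>R v)"
      using span_finite[of "lat_pt ` B"] finB by auto
    then have "x = (\<Sum>b\<in>B. c (lat_pt b) *\<^sub>R lat_pt b)"
      by (simp add: sum.reindex[OF inj_on_subset[OF inj_lat_pt subset_UNIV]])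
    then show ?thesis by (rule exI[of _ "\<lambda>b. c (lat_pt b)"])
  qed
  let ?G = "range (\<lambda>z. w \<bullet> lat_pt z)"
  let ?R = "{z::int^'n. norm (lat_pt z) \<le> (\<Sum>b\<in>B. norm (lat_pt b))}"
  \<comment> \<open>The endpoint 1 is listed separately because \<open>frac\<close> sends it to
    0.\<close>
  have "?G \<inter> {0..1} \<subseteq> insert 1 ((\<lambda>z. frac (w \<bullet> lat_pt z)) ` ?R)"
  proof
    fix y assume y: "y \<in> ?G \<inter> {0..1}"
    then obtain z where z: "y = w \<bullet> lat_pt z" by blast
    obtain c where c: "lat_pt z = (\<Sum>b\<in>B. c b *\<^sub>R lat_pt b)" using spanB by blast
    define r where "r = z - (\<Sum>b\<in>B. \<lfloor>c b\<rfloor> *s b)"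
    have "w \<bullet> lat_pt b \<in> \<int>" if "b \<in> B" for b using that w(4) by (auto simp: B_def)
    then have "(\<Sum>b\<in>B. of_int \<lfloor>c b\<rfloor> * (w \<bullet> lat_pt b)) \<in> \<int>"
      by (intro Ints_sum Ints_mult) auto
    moreover have "w \<bullet> lat_pt r = y - (\<Sum>b\<in>B. of_int \<lfloor>c b\<rfloor> * (w \<bullet> lat_pt b))"
      by (simp add: z r_def lat_pt_diff lat_pt_sum lat_pt_scale inner_diff_right inner_sum_right)
    ultimately have "frac (w \<bullet> lat_pt r) = frac y"
      by (auto simp: frac_def elim!: Ints_cases)
    moreover have "r \<in> ?R" using norm_fractional_part_le[OF c] by (simp add: r_def)
    moreover have "y = 1 \<or> frac y = y" using y by (auto simp: frac_eq)
    ultimately show "y \<in> insert 1 ((\<lambda>z. frac (w \<bullet> lat_pt z)) ` ?R)" by force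
  qed
  then have "finite (?G \<inter> {0..1})"
    by (rule finite_subset) (simp add: finite_bounded_lattice)
  moreover have "1 \<in> ?G" using w(4) by (metis rangeI)
  moreover have "x - y \<in> ?G" if "x \<in> ?G" "y \<in> ?G" for x y
    using that by (auto simp: inner_diff_right[symmetric] lat_pt_diff[symmetric])
  ultimately obtain g where g: "0 < g" "?G = range (\<lambda>m::int. of_int m * g)"
    using discrete_real_subgroup[of ?G] by blast
  have "range (\<lambda>z. ((1 / g) *\<^sub>R w) \<bullet> lat_pt z) = (\<lambda>y. y / g) ` ?G" by (auto simp: image_image)
  also have "\<dots> = \<int>" unfolding g(2) using g(1) by (auto simp: image_image Ints_def)
  finally show ?thesis using w g(1) by (intro exI[of _ "(1 / g) *\<^sub>R w"]) auto
qed

text \<open>For uniqueness, a competitor vanishes on the hyperplane of the facet and so is a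
  multiple of \<open>w\<close>. As both forms have value group \<int>, the factor is 1 or -1, and
  nonnegativity on the cone excludes -1.\<close>

lemma Fvec_props:
  assumes \<sigma>: "\<sigma> \<in> facets A"
  shows "Fvec A \<sigma> \<noteq> 0" "\<And>x. x \<in> cone_A A \<Longrightarrow> 0 \<le> Fvec A \<sigma> \<bullet> x"
    "\<sigma> = cone_A A \<inter> {x. Fvec A \<sigma> \<bullet> x = 0}" "range (\<lambda>z. Fvec A \<sigma> \<bullet> lat_pt z) = \<int>"
proof -
  obtain w where w: "w \<noteq> 0" "\<forall>x\<in>cone_A A. 0 \<le> w \<bullet> x" "\<sigma> = cone_A A \<inter> {x. w \<bullet> x = 0}"
     "range (\<lambda>z. w \<bullet> lat_pt z) = \<int>"
    using ex_primitive_form[OF \<sigma>] by blast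
  have "Fvec A \<sigma> = w"
    unfolding Fvec_def
  proof (rule the_equality)
    show "(\<forall>x\<in>cone_A A. 0 \<le> w \<bullet> x) \<and> (\<forall>x\<in>\<sigma>. w \<bullet> x = 0) \<and> range (\<lambda>z. w \<bullet> lat_pt z) = \<int>"
      using w by auto
  next
    fix v assume v: "(\<forall>x\<in>cone_A A. 0 \<le> v \<bullet> x) \<and> (\<forall>x\<in>\<sigma>. v \<bullet> x = 0) \<and> range (\<lambda>z. v \<bullet> lat_pt z) = \<int>"
    \<comment> \<open>The coefficient of the orthogonal projection of \<open>v\<close> to
      \<open>w\<close>. The remainder is orthogonal to \<open>w\<close>, hence also to
      \<open>v\<close>, hence to itself.\<close>
    define c where "c = (v \<bullet> w) / (w \<bullet> w)"
    have span: "{x. w \<bullet> x = 0} = span (lat_pt ` {a\<in>A. w \<bullet> lat_pt a = 0})"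
      using span_face_generators[OF \<sigma> w(1) _ w(3)] w(2) by blast
    also have "\<dots> \<subseteq> {x. v \<bullet> x = 0}"
    proof (rule span_minimal)
      show "lat_pt ` {a\<in>A. w \<bullet> lat_pt a = 0} \<subseteq> {x. v \<bullet> x = 0}"
        using v w(3) lat_pt_in_cone by blast
    qed (rule subspace_hyperplane)
    finally have sub: "{x. w \<bullet> x = 0} \<subseteq> {x. v \<bullet> x = 0}" .
    have orth: "w \<bullet> (v - c *\<^sub>R w) = 0" using w(1) by (simp add: c_def inner_diff_right inner_commute)
    with sub have "v \<bullet> (v - c *\<^sub>R w) = 0" by blast
    with orth have "(v - c *\<^sub>R w) \<bullet> (v - c *\<^sub>R w) = 0" by (simp add: inner_diff_left)
    then have vc: "v = c *\<^sub>R w" by simp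
    obtain z where z: "w \<bullet> lat_pt z = 1" using w(4) by (metis Ints_1 imageE)
    obtain y where y: "v \<bullet> lat_pt y = 1" using v by (metis Ints_1 imageE)
    have "c \<in> \<int>" using z v vc by (metis inner_scaleR_left mult.right_neutral rangeI)
    then obtain m where m: "c = of_int m" by (auto elim: Ints_cases)
    have "w \<bullet> lat_pt y \<in> \<int>" using w(4) by (metis rangeI)
    then obtain l where l: "w \<bullet> lat_pt y = of_int l" by (auto elim: Ints_cases)
    have "of_int (m * l) = (1::real)" using y by (simp add: vc m l)
    then have "m * l = 1" by linarith
    then have "m = 1 \<or> m = -1" by (auto simp: zmult_eq_1_iff)
    moreover obtain a where a: "a \<in> A" "0 < w \<bullet> lat_pt a" using ex_generator_pos[OF w(1)] w(2) by blast
    have "0 \<le> c * (w \<bullet> lat_pt a)"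
      using v lat_pt_in_cone[OF a(1)] by (auto simp: vc)
    ultimately show "v = w" using a vc by (auto simp: m)
  qed
  with w show "Fvec A \<sigma> \<noteq> 0" "\<And>x. x \<in> cone_A A \<Longrightarrow> 0 \<le> Fvec A \<sigma> \<bullet> x"
    "\<sigma> = cone_A A \<inter> {x. Fvec A \<sigma> \<bullet> x = 0}" "range (\<lambda>z. Fvec A \<sigma> \<bullet> lat_pt z) = \<int>"
    by auto
qed

text \<open>A segment from an interior point \<open>y\<close> to a point \<open>x\<close> outside
  crosses the boundary in some facet. There the facet form vanishes, although it is positive at
  \<open>y\<close> and nonnegative at \<open>x\<close>.\<close>

lemma in_cone_A_if_forms_nonneg:
  assumes nonneg: "\<And>\<sigma>. \<sigma> \<in> facets A \<Longrightarrow> 0 \<le> Fvec A \<sigma> \<bullet> x"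
  shows "x \<in> cone_A A"
proof (rule ccontr)
  assume x: "x \<notin> cone_A A"
  obtain y where y: "y \<in> interior (cone_A A)" using interior_cone_A_nonempty by blast
  then have "y \<in> cone_A A" using interior_subset by blast
  then have "closed_segment y x \<inter> frontier (cone_A A) \<noteq> {}"
    using x by (intro connected_Int_frontier) auto
  then obtain z where z: "z \<in> closed_segment y x" "z \<in> frontier (cone_A A)" by blast
  have closed: "closed (cone_A A)" by (rule polyhedron_imp_closed[OF polyhedron_cone_A])
  have "frontier (cone_A A) = rel_frontier (cone_A A)"
    by (simp add: rel_frontier_def frontier_def rel_interior_interior[OF affine_hull_cone_A])
  with z(2) obtain \<sigma> where \<sigma>: "\<sigma> \<in> facets A" "z \<in> \<sigma>"
    using rel_frontier_of_polyhedron[OF polyhedron_cone_A] by (auto simp: facets_def)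
  note w = Fvec_props[OF \<sigma>(1)]
  let ?w = "Fvec A \<sigma>"
  have zc: "z \<in> cone_A A" "?w \<bullet> z = 0" using \<sigma>(2) w(3) by auto
  obtain e where e: "0 < e" "ball y e \<subseteq> cone_A A" using y by (auto simp: mem_interior)
  \<comment> \<open>Moving \<open>y\<close> by half the radius against the normal stays in the ball,
    which makes the form strictly positive at \<open>y\<close>.\<close>
  define d where "d = e / (2 * norm ?w)"
  have d: "0 < d" using e w(1) by (simp add: d_def)
  have "y - d *\<^sub>R ?w \<in> ball y e" using e w(1) by (simp add: dist_norm d_def)
  then have "0 \<le> ?w \<bullet> (y - d *\<^sub>R ?w)" using e(2) w(2) by blast
  moreover have "0 < d * (?w \<bullet> ?w)" using d w(1) by simp
  ultimately have wy: "0 < ?w \<bullet> y" by (simp add: inner_diff_right)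
  obtain t where t: "0 \<le> t" "t \<le> 1" "z = (1 - t) *\<^sub>R y + t *\<^sub>R x"
    using z(1) by (auto simp: in_segment)
  have "t \<noteq> 1" using t(3) zc x by auto
  then have "0 < (1 - t) * (?w \<bullet> y)" using t wy by simp
  moreover have "0 \<le> t * (?w \<bullet> x)" using t nonneg[OF \<sigma>(1)] by simp
  ultimately show False using zc(2) by (simp add: t(3) inner_add_right)
qed

section \<open>Integer values of the facet forms on the lattice\<close>

definition form :: "(real^'n) set \<Rightarrow> int^'n \<Rightarrow> int" where
  "form \<sigma> z = \<lfloor>Fvec A \<sigma> \<bullet> lat_pt z\<rfloor>"

text \<open>The floor in \<open>form\<close> rounds nothing away: it only moves integral values from
  \<open>real\<close> to \<open>int\<close>.\<close>

lemma of_int_form: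
  assumes "\<sigma> \<in> facets A" shows "of_int (form \<sigma> z) = Fvec A \<sigma> \<bullet> lat_pt z"
proof -
  have "Fvec A \<sigma> \<bullet> lat_pt z \<in> \<int>" using Fvec_props(4)[OF assms] by blast
  then show ?thesis by (auto simp: form_def elim: Ints_cases)
qed

lemma form_add: "\<sigma> \<in> facets A \<Longrightarrow> form \<sigma> (x + y) = form \<sigma> x + form \<sigma> y"
proof -
  assume \<sigma>: "\<sigma> \<in> facets A"
  have "(of_int (form \<sigma> (x + y)) :: real) = of_int (form \<sigma> x + form \<sigma> y)"
    by (simp add: of_int_form[OF \<sigma>] lat_pt_add inner_add_right)
  then show ?thesis by (simp only: of_int_eq_iff)
qed

lemma form_scale: "\<sigma> \<in> facets A \<Longrightarrow> form \<sigma> (k *s x) = k * form \<sigma> x"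
proof -
  assume \<sigma>: "\<sigma> \<in> facets A"
  have "(of_int (form \<sigma> (k *s x)) :: real) = of_int (k * form \<sigma> x)"
    by (simp add: of_int_form[OF \<sigma>] lat_pt_scale)
  then show ?thesis by (simp only: of_int_eq_iff)
qed

lemma form_sum: "\<sigma> \<in> facets A \<Longrightarrow> form \<sigma> (\<Sum>j\<in>B. f j) = (\<Sum>j\<in>B. form \<sigma> (f j))"
  using form_scale[of \<sigma> 0]
  by (induction B rule: infinite_finite_induct) (simp_all add: form_add)

lemma form_generator_nonneg: "\<sigma> \<in> facets A \<Longrightarrow> a \<in> A \<Longrightarrow> 0 \<le> form \<sigma> a"
  using Fvec_props(2)[OF _ lat_pt_in_cone] by (simp add: form_def)

lemma form_NA_nonneg: "\<sigma> \<in> facets A \<Longrightarrow> z \<in> NA A \<Longrightarrow> 0 \<le> form \<sigma> z"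
  unfolding NA_iff
  by (auto simp: form_sum form_scale form_generator_nonneg intro!: sum_nonneg)

lemma form_surj: assumes \<sigma>: "\<sigma> \<in> facets A" shows "\<exists>z. form \<sigma> z = m"
proof -
  have "of_int m \<in> range (\<lambda>z. Fvec A \<sigma> \<bullet> lat_pt z)" using Fvec_props(4)[OF \<sigma>] by simp
  then show ?thesis by (auto simp: form_def intro: exI[of _ "_ :: int^'n"]) (metis floor_of_int)
qed

definition formNA :: "(real^'n) set \<Rightarrow> int set" where
  "formNA \<sigma> = form \<sigma> ` NA A"

lemma FNA_eq: "\<sigma> \<in> facets A \<Longrightarrow> FNA A \<sigma> = of_int ` formNA \<sigma>"
  by (simp add: FNA_def formNA_def image_image of_int_form F_def)

lemma scored_iff:
  "scored A \<longleftrightarrow> NA A = {z. \<forall>\<sigma>\<in>facets A. form \<sigma> z \<in> formNA \<sigma>}"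
proof -
  have "(\<Inter>\<sigma>\<in>facets A. {a. F A \<sigma> (lat_pt a) \<in> FNA A \<sigma>}) = {z. \<forall>\<sigma>\<in>facets A. form \<sigma> z \<in> formNA \<sigma>}"
    by (auto simp: F_def FNA_eq of_int_form[symmetric])
  then show ?thesis by (simp add: scored_def)
qed

text \<open>The integral combination of the generators representing \<open>z\<close> becomes nonnegative after adding
  a fixed multiple of the sum of all generators; this multiple is uniform over a finite set.\<close>

lemma ex_shift_into_NA:
  assumes "finite R"
  shows "\<exists>b\<in>NA A. \<forall>z\<in>R. b + z \<in> NA A"
proof -
  obtain k where k: "\<And>z. z = (\<Sum>a\<in>A. k z a *s a)" using lattice_combination by metis
  define N where "N = (\<Sum>z\<in>R. \<Sum>a\<in>A. \<bar>k z a\<bar>)"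
  have N: "\<bar>k z a\<bar> \<le> N" if "z \<in> R" "a \<in> A" for z a
  proof -
    have "\<bar>k z a\<bar> \<le> (\<Sum>a\<in>A. \<bar>k z a\<bar>)" using that finite_A by (intro member_le_sum) auto
    also have "\<dots> \<le> N" unfolding N_def using that assms
      by (intro member_le_sum[of z R "\<lambda>z. \<Sum>a\<in>A. \<bar>k z a\<bar>"]) (auto intro: sum_nonneg)
    finally show ?thesis .
  qed
  have "0 \<le> N" unfolding N_def by (intro sum_nonneg) auto
  show ?thesis
  proof (intro bexI ballI)
    show "(\<Sum>a\<in>A. N *s a) \<in> NA A"
      unfolding NA_iff using \<open>0 \<le> N\<close> by (intro exI[of _ "\<lambda>_. N"]) simp
    fix z assume z: "z \<in> R"
    have "(\<Sum>a\<in>A. N *s a) + z = (\<Sum>a\<in>A. (N + k z a) *s a)"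
      by (subst k[of z]) (simp add: sum.distrib vector_sadd_rdistrib)
    moreover have "\<forall>a\<in>A. 0 \<le> N + k z a"
    proof
      fix a assume "a \<in> A"
      from N[OF z this] show "0 \<le> N + k z a" by linarith
    qed
    ultimately show "(\<Sum>a\<in>A. N *s a) + z \<in> NA A"
      unfolding NA_iff by (intro exI[of _ "\<lambda>a. N + k z a"] conjI)
  qed
qed

text \<open>As in Gordan's lemma, a lattice point of the cone is an element of \<nat>A plus a
  remainder from a fixed finite set, and one shift \<open>b\<close> moves all remainders into
  \<nat>A.\<close>

lemma ex_conductor:
  "\<exists>b\<in>NA A. \<forall>z. (\<forall>\<sigma>\<in>facets A. 0 \<le> form \<sigma> z) \<longrightarrow> b + z \<in> NA A"
proof -
  let ?R = "{z::int^'n. norm (lat_pt z) \<le> (\<Sum>b\<in>A. norm (lat_pt b))}"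
  obtain b where b: "b \<in> NA A" "\<forall>z\<in>?R. b + z \<in> NA A"
    using ex_shift_into_NA[OF finite_bounded_lattice] by blast
  have "b + z \<in> NA A" if z: "\<forall>\<sigma>\<in>facets A. 0 \<le> form \<sigma> z" for z
  proof -
    have "lat_pt z \<in> cone_A A"
      by (rule in_cone_A_if_forms_nonneg) (use z in \<open>simp flip: of_int_form\<close>)
    then obtain c where c: "\<forall>a\<in>A. 0 \<le> c a" "lat_pt z = (\<Sum>a\<in>A. c a *\<^sub>R lat_pt a)"
      by (auto simp: cone_A_def)
    from b(2) norm_fractional_part_le[OF c(2)] have "b + (z - (\<Sum>a\<in>A. \<lfloor>c a\<rfloor> *s a)) \<in> NA A" by blast
    moreover have "(\<Sum>a\<in>A. \<lfloor>c a\<rfloor> *s a) \<in> NA A"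
      unfolding NA_iff using c(1) by (intro exI[of _ "\<lambda>a. \<lfloor>c a\<rfloor>"]) simp
    ultimately have "b + (z - (\<Sum>a\<in>A. \<lfloor>c a\<rfloor> *s a)) + (\<Sum>a\<in>A. \<lfloor>c a\<rfloor> *s a) \<in> NA A" by (rule NA_add)
    then show ?thesis by simp
  qed
  with b(1) show ?thesis by blast
qed

text \<open>Take a generator \<open>a\<close> of value \<open>p\<close> > 0 and a lattice point
  \<open>z\<close> of value 1. A fixed \<open>u\<close> moves the multiples of \<open>z\<close>
  representing all residues modulo \<open>p\<close> into \<nat>A, and multiples of \<open>a\<close>
  reach the remaining values.\<close>

lemma formNA_cofinite:
  assumes \<sigma>: "\<sigma> \<in> facets A"
  shows "\<exists>K. \<forall>m\<ge>K. m \<in> formNA \<sigma>"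
proof -
  obtain a where a: "a \<in> A" "0 < Fvec A \<sigma> \<bullet> lat_pt a"
    using ex_generator_pos[of "Fvec A \<sigma>"] Fvec_props[OF \<sigma>] by blast
  define p where "p = form \<sigma> a"
  have "(0::real) < of_int p" using a(2) by (simp add: p_def of_int_form[OF \<sigma>])
  then have p: "0 < p" by simp
  obtain z where z: "form \<sigma> z = 1" using form_surj[OF \<sigma>] by blast
  obtain u where u: "u \<in> NA A" "\<forall>y\<in>(\<lambda>j. j *s z) ` {0..p}. u + y \<in> NA A"
    using ex_shift_into_NA[of "(\<lambda>j. j *s z) ` {0..p}"] by auto
  have "m \<in> formNA \<sigma>" if m: "form \<sigma> u \<le> m" for m
  proof -
    define n where "n = m - form \<sigma> u"
    have n: "0 \<le> n" using m by (simp add: n_def)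
    have "u + (n mod p) *s z \<in> NA A" using u(2) p by (simp add: less_imp_le)
    then have "u + (n mod p) *s z + (n div p) *s a \<in> NA A"
      using p n by (rule_tac NA_add[OF _ NA_scale[OF _ A_subset_NA[OF a(1)]]])
        (auto simp: pos_imp_zdiv_nonneg_iff)
    moreover have "form \<sigma> (u + (n mod p) *s z + (n div p) *s a) = m"
      using z by (simp add: form_add[OF \<sigma>] form_scale[OF \<sigma>] p_def[symmetric] n_def)
    ultimately show ?thesis unfolding formNA_def by blast
  qed
  then show ?thesis by blast
qed

section \<open>Complex extension of the facet forms\<close>

lemma Fc_add: "Fc A \<sigma> (x + y) = Fc A \<sigma> x + Fc A \<sigma> y"
  by (simp add: Fc_def sum.distrib algebra_simps)

lemma Fc_cv: "\<sigma> \<in> facets A \<Longrightarrow> Fc A \<sigma> (cv z) = of_int (form \<sigma> z)"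
proof -
  assume \<sigma>: "\<sigma> \<in> facets A"
  have "Fc A \<sigma> (cv z) = of_real (Fvec A \<sigma> \<bullet> lat_pt z)"
    by (simp add: Fc_def inner_vec_def)
  also have "\<dots> = of_real (of_int (form \<sigma> z))" using of_int_form[OF \<sigma>] by metis
  finally show ?thesis by simp
qed

lemma Fc_polyfun: "Fc A \<sigma> \<in> polyfun"
  unfolding Fc_def by (intro polyfun_sum polyfun.mult polyfun.const polyfun.coord)

text \<open>The real and imaginary parts of \<open>x\<close> lie in the real hyperplane, which is
  spanned by the generators in the facet.\<close>

lemma Fc_kernel:
  assumes \<sigma>: "\<sigma> \<in> facets A" and x: "Fc A \<sigma> x = 0"
  shows "\<exists>c. x = (\<Sum>a | a \<in> A \<and> form \<sigma> a = 0. c a *s cv a)"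
proof -
  let ?B = "{a \<in> A. form \<sigma> a = 0}"
  have B: "?B = {a \<in> A. Fvec A \<sigma> \<bullet> lat_pt a = 0}"
    by (auto simp flip: of_int_form[OF \<sigma>])
  have finB: "finite ?B" using finite_A by simp
  have real: "\<exists>c. y = (\<Sum>a\<in>?B. c a *\<^sub>R lat_pt a)" if "Fvec A \<sigma> \<bullet> y = 0" for y
  proof -
    have "y \<in> span (lat_pt ` ?B)"
      unfolding B using that Fvec_props[OF \<sigma>] span_face_generators[OF \<sigma>, of "Fvec A \<sigma>"] by blast
    then obtain c where "y = (\<Sum>v\<in>lat_pt ` ?B. c v *\<^sub>R v)"
      using span_finite[of "lat_pt ` ?B"] finB by auto
    then have "y = (\<Sum>b\<in>?B. c (lat_pt b) *\<^sub>R lat_pt b)"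
      by (simp add: sum.reindex[OF inj_on_subset[OF inj_lat_pt subset_UNIV]])
    then show ?thesis by (rule exI[of _ "\<lambda>b. c (lat_pt b)"])
  qed
  have "Fvec A \<sigma> \<bullet> (\<chi> i. Re (x $ i)) = Re (Fc A \<sigma> x)" "Fvec A \<sigma> \<bullet> (\<chi> i. Im (x $ i)) = Im (Fc A \<sigma> x)"
    by (simp_all add: Fc_def inner_vec_def)
  with x obtain c d where c: "(\<chi> i. Re (x $ i)) = (\<Sum>a\<in>?B. c a *\<^sub>R lat_pt a)"
    and d: "(\<chi> i. Im (x $ i)) = (\<Sum>a\<in>?B. d a *\<^sub>R lat_pt a)"
    using real[of "\<chi> i. Re (x $ i)"] real[of "\<chi> i. Im (x $ i)"] by auto
  have "x = (\<Sum>a\<in>?B. Complex (c a) (d a) *s cv a)"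
  proof (rule vec_eq_iff[THEN iffD2], rule allI)
    fix i
    have "Re (x $ i) = (\<Sum>a\<in>?B. c a * of_int (a $ i))" "Im (x $ i) = (\<Sum>a\<in>?B. d a * of_int (a $ i))"
      using arg_cong[OF c, of "\<lambda>v. v $ i"] arg_cong[OF d, of "\<lambda>v. v $ i"] by simp_all
    then show "x $ i = (\<Sum>a\<in>?B. Complex (c a) (d a) *s cv a) $ i"
      by (simp add: complex_eq_iff)
  qed
  then show ?thesis by (rule exI[of _ "\<lambda>a. Complex (c a) (d a)"])
qed

lemma Fplus_iff: "\<sigma> \<in> Fplus A \<alpha> \<longleftrightarrow> \<sigma> \<in> facets A \<and> (\<exists>m\<in>formNA \<sigma>. Fc A \<sigma> \<alpha> = of_int m)"
  by (auto simp: Fplus_def FNA_eq image_image image_iff)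

lemma Fminus_iff:
  "\<sigma> \<in> Fminus A \<alpha> \<longleftrightarrow> \<sigma> \<in> facets A \<and> (\<exists>m. m \<notin> formNA \<sigma> \<and> Fc A \<sigma> \<alpha> = of_int m)"
  by (auto simp: Fminus_def FNA_eq image_image image_iff Ints_def)

end

section \<open>Simplicity\<close>

lemma cv_scale: "cv (k *s a) = of_int k *s cv a"
  by (simp add: vec_eq_iff)

lemma cv_sum: "cv (\<Sum>j\<in>B. f j) = (\<Sum>j\<in>B. cv (f j))"
  by (induction B rule: infinite_finite_induct) (simp_all add: cv_add)

text \<open>Gordan's theorem: if 0 were outside the compact convex hull of \<open>V\<close>, a
  separating hyperplane would give a functional positive on \<open>V\<close>.\<close>

lemma ex_nonpos_combination_if_no_pos_functional:
  fixes V :: "'a::euclidean_space set"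
  assumes "finite V" "\<nexists>\<gamma>. \<forall>v\<in>V. 0 < v \<bullet> \<gamma>"
  shows "\<exists>u. (\<forall>v\<in>V. 0 \<le> u v) \<and> sum u V = 1 \<and> (\<Sum>v\<in>V. u v *\<^sub>R v) = 0"
proof -
  have "0 \<in> convex hull V"
  proof (rule ccontr)
    assume "0 \<notin> convex hull V"
    moreover have "closed (convex hull V)"
      using assms(1) by (simp add: finite_imp_compact_convex_hull compact_imp_closed)
    ultimately obtain a b where "0 < b" "\<forall>x\<in>convex hull V. b < a \<bullet> x"
      using separating_hyperplane_closed_0[of "convex hull V"] by auto
    then have "\<forall>v\<in>V. 0 < v \<bullet> a"
      by (metis hull_inc inner_commute less_trans)
    with assms(2) show False by blast
  qed
  then show ?thesis unfolding convex_hull_finite[OF assms(1)] by blast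
qed

context lattice_gens
begin

text \<open>\<open>f\<^sub>a\<close> vanishes on all points of \<open>\<nat>A\<close> in the hyperplane \<open>F\<^sub>\<sigma> = m\<close>, and these contain a translate of
  the monoid generated by the facet, hence are Zariski dense in the hyperplane.\<close>

lemma D_R_symbol_zero:
  assumes P: "P \<in> D_R A" and \<sigma>: "\<sigma> \<in> facets A" and \<beta>: "Fc A \<sigma> \<beta> = of_int m"
    and m: "m \<in> formNA \<sigma>" "m + form \<sigma> a \<notin> formNA \<sigma>"
  shows "symbol P a \<beta> = 0"
proof -
  let ?B = "{a \<in> A. form \<sigma> a = 0}"
  obtain b where b: "b \<in> NA A" "form \<sigma> b = m" using m(1) by (auto simp: formNA_def)
  have "Fc A \<sigma> (cv b + (\<beta> - cv b)) = of_int m" using \<beta> by simp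
  then have "Fc A \<sigma> (\<beta> - cv b) = 0" unfolding Fc_add Fc_cv[OF \<sigma>] b(2) by simp
  then obtain c where c: "\<beta> - cv b = (\<Sum>a\<in>?B. c a *s cv a)" using Fc_kernel[OF \<sigma>] by blast
  have "symbol P a (cv b + (\<Sum>a\<in>?B. c a *s cv a)) = 0"
  proof (rule polyfun_zero_on_lattice_cone)
    show "symbol P a \<in> polyfun" by (rule symbol_polyfun[OF D_R_weyl_ops[OF P]])
    show "finite ?B" using finite_A by simp
    fix n :: "int^'n \<Rightarrow> nat"
    define z where "z = (\<Sum>a\<in>?B. int (n a) *s a)"
    have "z \<in> NA A" unfolding z_def by (intro NA_sum NA_scale A_subset_NA) auto
    moreover have "form \<sigma> z = 0" by (simp add: z_def form_sum[OF \<sigma>] form_scale[OF \<sigma>])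
    ultimately have "b + z \<in> NA A" "b + z + a \<notin> NA A"
      using b m(2) by (auto intro: NA_add simp: formNA_def form_add[OF \<sigma>] image_iff)
    then have "symbol P a (cv (b + z)) = 0" using P by (auto simp: D_R_iff)
    then show "symbol P a (cv b + (\<Sum>a\<in>?B. of_nat (n a) *s cv a)) = 0"
      by (simp add: cv_add z_def cv_sum cv_scale)
  qed
  then show ?thesis by (simp flip: c)
qed

text \<open>The vanishing lemma read contrapositively: if a facet left \<open>Fplus\<close>, the
  coefficient of t^(\<beta>+a) in P t^\<beta> would be 0.\<close>

lemma Fplus_mono:
  assumes "P \<in> D_R A" "symbol P a \<beta> \<noteq> 0"
  shows "Fplus A \<beta> \<subseteq> Fplus A (\<beta> + cv a)"
proof
  fix \<sigma> assume "\<sigma> \<in> Fplus A \<beta>"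
  then obtain m where m: "\<sigma> \<in> facets A" "m \<in> formNA \<sigma>" "Fc A \<sigma> \<beta> = of_int m"
    by (auto simp: Fplus_iff)
  then have "m + form \<sigma> a \<in> formNA \<sigma>" using assms D_R_symbol_zero by blast
  with m show "\<sigma> \<in> Fplus A (\<beta> + cv a)"
    by (auto simp: Fplus_iff Fc_add Fc_cv intro!: bexI[of _ "m + form \<sigma> a"])
qed

section \<open>Finite unions of facet hyperplanes\<close>

definition hyperplanes_poly :: "((real^'n) set \<Rightarrow> int set) \<Rightarrow> complex^'n \<Rightarrow> complex" where
  "hyperplanes_poly M x = (\<Prod>\<sigma>\<in>facets A. \<Prod>m\<in>M \<sigma>. Fc A \<sigma> x - of_int m)"

lemma hyperplanes_poly_polyfun: "hyperplanes_poly M \<in> polyfun"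
  unfolding hyperplanes_poly_def
  by (intro polyfun_prod polyfun_diff Fc_polyfun polyfun.const)

lemma hyperplanes_poly_eq_0_iff:
  assumes "\<And>\<sigma>. \<sigma> \<in> facets A \<Longrightarrow> finite (M \<sigma>)"
  shows "hyperplanes_poly M x = 0 \<longleftrightarrow> (\<exists>\<sigma>\<in>facets A. \<exists>m\<in>M \<sigma>. Fc A \<sigma> x = of_int m)"
  unfolding hyperplanes_poly_def using assms finite_facets by simp

lemma hyperplanes_poly_nonzero:
  assumes fin: "\<And>\<sigma>. \<sigma> \<in> facets A \<Longrightarrow> finite (M \<sigma>)"
  shows "\<exists>x. hyperplanes_poly M x \<noteq> 0"
  unfolding hyperplanes_poly_def
proof (intro polyfun_nonzero_prod finite_facets fin polyfun_prod polyfun_diff Fc_polyfun polyfun.const)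
  fix \<sigma> m assume \<sigma>: "\<sigma> \<in> facets A"
  obtain z where "form \<sigma> z = m + 1" using form_surj[OF \<sigma>] by blast
  then show "\<exists>x. Fc A \<sigma> x - of_int m \<noteq> 0"
    by (intro exI[of _ "cv z"]) (simp add: Fc_cv[OF \<sigma>])
qed

section \<open>Necessity of the two conditions\<close>

text \<open>Both necessity proofs end here: they exhibit a proper ideal containing a nonzero
  polynomial in \<theta>.\<close>

lemma simple_D_R_proper_ideal_trivial:
  assumes "simple_alg (D_R A)" "two_sided_ideal (D_R A) I" "homop 0 (\<lambda>_. 1) \<notin> I"
    and "p \<in> polyfun" "homop 0 p \<in> I"
  shows "p x = 0"
proof -
  have "homop 0 (\<lambda>_. 1) \<in> D_R A" by (intro homop_0_in_D_R polyfun.const)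
  with assms have "I = {\<lambda>_. 0}" unfolding simple_alg_def by blast
  with assms(5) have "homop 0 p = homop 0 (\<lambda>_. 0)" by (simp add: homop_zero)
  then have "symbol (homop 0 p) 0 = symbol (homop (0 :: int^'n) (\<lambda>_. 0)) 0" by simp
  then show ?thesis using assms(4) by (simp add: symbol_homop polyfun.const)
qed

text \<open>The scored closure \<open>S\<close> of \<open>\<nat>A\<close> is preserved by \<open>D(R\<^sub>A)\<close>, and \<open>S - \<nat>A\<close> lies in finitely many
  hyperplanes, so the annihilator of \<open>\<complex>[S] / R\<^sub>A\<close> is a nonzero ideal.\<close>

lemma scored_if_simple:
  assumes simple: "simple_alg (D_R A)"
  shows "scored A"
proof (rule ccontr)
  assume nscored: "\<not> scored A"
  define S where "S = {z. \<forall>\<sigma>\<in>facets A. form \<sigma> z \<in> formNA \<sigma>}"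
  have NA_S: "NA A \<subseteq> S" by (auto simp: S_def formNA_def)
  then obtain z0 where z0: "z0 \<in> S" "z0 \<notin> NA A" using nscored by (auto simp: scored_iff S_def)
  define I where "I = {P \<in> D_R A. \<forall>g. Poly_Mapping.keys g \<subseteq> S \<longrightarrow> Poly_Mapping.keys (P g) \<subseteq> NA A}"
  have pres: "Poly_Mapping.keys (P g) \<subseteq> S" if P: "P \<in> D_R A" and g: "Poly_Mapping.keys g \<subseteq> S" for P g
  proof -
    have "symbol P a (cv b) = 0" if "b \<in> S" "b + a \<notin> S" for a b
      using that D_R_symbol_zero[OF P _ Fc_cv] by (auto simp: S_def form_add)
    then show ?thesis using g weyl_ops_maps_iff[OF D_R_weyl_ops[OF P], of S S] by blast
  qed
  have NA_pres: "Poly_Mapping.keys (P g) \<subseteq> NA A" if "P \<in> D_R A" "Poly_Mapping.keys g \<subseteq> NA A" for P g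
    using that by (auto simp: D_R_def R_A_def)
  have I: "two_sided_ideal (D_R A) I"
    unfolding two_sided_ideal_def
  proof (intro conjI ballI)
    show "I \<subseteq> D_R A" by (auto simp: I_def)
    have "homop 0 (\<lambda>_. 0) \<in> D_R A" by (intro homop_0_in_D_R polyfun.const)
    then show "(\<lambda>_. 0) \<in> I" by (simp add: I_def homop_zero)
  next
    fix P Q assume "P \<in> I" "Q \<in> I"
    then show "(\<lambda>f. P f - Q f) \<in> I"
      by (auto simp: I_def intro!: D_R_diff dest!: subsetD[OF keys_diff])
  next
    fix P Q assume P: "P \<in> D_R A" and Q: "Q \<in> I"
    from Q have QD: "Q \<in> D_R A"
      and Q_maps: "\<And>g. Poly_Mapping.keys g \<subseteq> S \<Longrightarrow> Poly_Mapping.keys (Q g) \<subseteq> NA A"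
      by (simp_all add: I_def)
    show "P \<circ> Q \<in> I" using P QD by (simp add: I_def D_R_comp NA_pres Q_maps)
    show "Q \<circ> P \<in> I" using P QD by (simp add: I_def D_R_comp pres Q_maps)
  qed
  obtain b where b: "b \<in> NA A" "\<And>z. \<forall>\<sigma>\<in>facets A. 0 \<le> form \<sigma> z \<Longrightarrow> b + z \<in> NA A"
    using ex_conductor by blast
  \<comment> \<open>If \<open>z\<close> in \<open>S\<close> is not in \<nat>A, then z - b has a
    negative facet value by the choice of \<open>b\<close>, so \<open>z\<close> has a facet value
    from 0 up to but excluding that of \<open>b\<close>.\<close>
  define f where "f = hyperplanes_poly (\<lambda>\<sigma>. {0..<form \<sigma> b})"
  have f: "f \<in> polyfun" unfolding f_def by (rule hyperplanes_poly_polyfun)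
  have "f (cv z) = 0" if z: "z \<in> S" "z \<notin> NA A" for z
  proof -
    have "b + (z - b) \<notin> NA A" using z by simp
    then obtain \<sigma> where \<sigma>: "\<sigma> \<in> facets A" "form \<sigma> (z - b) < 0"
      using b(2)[of "z - b"] by force
    have "form \<sigma> (z - b) + form \<sigma> b = form \<sigma> z" using form_add[OF \<sigma>(1), of "z - b" b] by simp
    moreover have "0 \<le> form \<sigma> z" using z(1) \<sigma>(1) form_NA_nonneg by (auto simp: S_def formNA_def)
    ultimately show ?thesis unfolding f_def using \<sigma> Fc_cv[OF \<sigma>(1)]
      by (subst hyperplanes_poly_eq_0_iff) force+
  qed
  then have f_I: "homop 0 f \<in> I"
    unfolding I_def using weyl_ops_maps_iff[OF homop_in_weyl_ops[OF f, of 0], of S "NA A"]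
    by (auto simp: homop_0_in_D_R f symbol_homop)
  have one: "homop 0 (\<lambda>_. 1) \<notin> I"
  proof
    assume "homop 0 (\<lambda>_. 1) \<in> I"
    then have maps: "\<forall>g::'n laurent. Poly_Mapping.keys g \<subseteq> S \<longrightarrow> Poly_Mapping.keys g \<subseteq> NA A"
      by (simp add: I_def homop_one)
    have "Poly_Mapping.keys (Poly_Mapping.single z0 (1::complex)) \<subseteq> S" using z0(1) by simp
    with maps have "Poly_Mapping.keys (Poly_Mapping.single z0 (1::complex)) \<subseteq> NA A" by blast
    with z0(2) show False by simp
  qed
  obtain x where "f x \<noteq> 0"
    using hyperplanes_poly_nonzero[of "\<lambda>\<sigma>. {0..<form \<sigma> b}"] by (auto simp: f_def)
  with simple_D_R_proper_ideal_trivial[OF simple I one f f_I] show False by simp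
qed

definition same_Fplus_class :: "complex^'n \<Rightarrow> (complex^'n) set" where
  "same_Fplus_class \<alpha> = {\<beta>. (\<exists>z. \<beta> = \<alpha> + cv z) \<and> Fplus A \<beta> = Fplus A \<alpha>}"

text \<open>On the class, facets in \<open>Fplus\<close> keep their values in the value set, hence
  nonnegative; facets in \<open>Fminus\<close> keep theirs outside it, hence below its cofinite
  part. The sign change turns the upper bounds into lower ones.\<close>

lemma same_Fplus_class_bounded_below:
  assumes v: "v \<in> Fvec A ` Fplus A \<alpha> \<union> uminus ` Fvec A ` Fminus A \<alpha>"
  shows "\<exists>K. \<forall>z. \<alpha> + cv z \<in> same_Fplus_class \<alpha> \<longrightarrow> - K \<le> v \<bullet> lat_pt z"
  using v
proof
  assume "v \<in> Fvec A ` Fplus A \<alpha>"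
  then obtain \<sigma> m where \<sigma>: "\<sigma> \<in> facets A" "v = Fvec A \<sigma>" "\<sigma> \<in> Fplus A \<alpha>" "Fc A \<sigma> \<alpha> = of_int m"
    by (auto simp: Fplus_iff)
  have "- of_int m \<le> v \<bullet> lat_pt z" if "\<alpha> + cv z \<in> same_Fplus_class \<alpha>" for z
  proof -
    have "\<sigma> \<in> Fplus A (\<alpha> + cv z)" using that \<sigma>(3) by (simp add: same_Fplus_class_def)
    then obtain k where k: "k \<in> formNA \<sigma>" "of_int m + of_int (form \<sigma> z) = (of_int k :: complex)"
      by (auto simp: Fplus_iff Fc_add Fc_cv \<sigma>(4))
    have "m + form \<sigma> z = k" using k(2) by (metis of_int_add of_int_eq_iff)
    moreover have "0 \<le> k" using k(1) form_NA_nonneg[OF \<sigma>(1)] by (auto simp: formNA_def)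
    ultimately have "- m \<le> form \<sigma> z" by simp
    then have "of_int (- m) \<le> (of_int (form \<sigma> z) :: real)" by (simp only: of_int_le_iff)
    then show ?thesis by (simp add: \<sigma>(2) of_int_form[OF \<sigma>(1)])
  qed
  then show ?thesis by blast
next
  assume "v \<in> uminus ` Fvec A ` Fminus A \<alpha>"
  then obtain \<sigma> m where \<sigma>: "\<sigma> \<in> facets A" "v = - Fvec A \<sigma>" "Fc A \<sigma> \<alpha> = of_int m" "m \<notin> formNA \<sigma>"
    by (auto simp: Fminus_iff)
  obtain K where K: "\<forall>m\<ge>K. m \<in> formNA \<sigma>" using formNA_cofinite[OF \<sigma>(1)] by blast
  have "\<sigma> \<notin> Fplus A \<alpha>" using \<sigma> by (auto simp: Fplus_iff)
  have "- of_int (K - m) \<le> v \<bullet> lat_pt z" if "\<alpha> + cv z \<in> same_Fplus_class \<alpha>" for z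
  proof -
    have "\<sigma> \<notin> Fplus A (\<alpha> + cv z)"
      using that \<open>\<sigma> \<notin> Fplus A \<alpha>\<close> by (simp add: same_Fplus_class_def)
    then have "m + form \<sigma> z \<notin> formNA \<sigma>"
      using \<sigma>(1) by (auto simp: Fplus_iff Fc_add Fc_cv \<sigma>(3) dest: bspec[of _ _ "m + form \<sigma> z"])
    then have "\<not> K \<le> m + form \<sigma> z" using K by blast
    then have "form \<sigma> z \<le> K - m" by linarith
    then have "of_int (form \<sigma> z) \<le> (of_int (K - m) :: real)" by (simp only: of_int_le_iff)
    then show ?thesis by (simp add: \<sigma>(2) of_int_form[OF \<sigma>(1)])
  qed
  then show ?thesis by blast
qed

text \<open>Gordan's theorem gives a nonnegative relation among the signed forms, all bounded below
  on the class. A form with positive coefficient is then also bounded above, so it takes finitely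
  many values.\<close>

lemma same_Fplus_class_in_hyperplanes:
  assumes empty: "Rpos A \<alpha> = {}"
  shows "\<exists>f\<in>polyfun. (\<exists>x. f x \<noteq> 0) \<and> (\<forall>\<beta>\<in>same_Fplus_class \<alpha>. f \<beta> = 0)"
proof -
  let ?V = "Fvec A ` Fplus A \<alpha> \<union> uminus ` Fvec A ` Fminus A \<alpha>"
  have finV: "finite ?V"
    using finite_facets by (auto simp: Fplus_def Fminus_def)
  have "\<nexists>\<gamma>. \<forall>v\<in>?V. 0 < v \<bullet> \<gamma>"
  proof
    assume "\<exists>\<gamma>. \<forall>v\<in>?V. 0 < v \<bullet> \<gamma>"
    then obtain \<gamma> where "\<forall>v\<in>?V. 0 < v \<bullet> \<gamma>" by blast
    then have "\<And>\<sigma>. \<sigma> \<in> Fplus A \<alpha> \<Longrightarrow> 0 < Fvec A \<sigma> \<bullet> \<gamma>"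
      "\<And>\<sigma>. \<sigma> \<in> Fminus A \<alpha> \<Longrightarrow> 0 < - Fvec A \<sigma> \<bullet> \<gamma>" by blast+
    then have "\<gamma> \<in> Rpos A \<alpha>" by (simp add: Rpos_def F_def)
    with empty show False by simp
  qed
  from ex_nonpos_combination_if_no_pos_functional[OF finV this] obtain u where
    u: "\<forall>v\<in>?V. 0 \<le> u v" "sum u ?V = 1" "(\<Sum>v\<in>?V. u v *\<^sub>R v) = 0" by (elim exE conjE)
  obtain K where K: "\<And>v z. v \<in> ?V \<Longrightarrow> \<alpha> + cv z \<in> same_Fplus_class \<alpha> \<Longrightarrow> - K v \<le> v \<bullet> lat_pt z"
    using same_Fplus_class_bounded_below[of _ \<alpha>] by metis
  obtain v where v: "v \<in> ?V" "u v \<noteq> 0" using u(2) by (metis sum.neutral zero_neq_one)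
  then have uv: "0 < u v" using u(1) by (metis order_less_le)
  \<comment> \<open>The relation is solved for \<open>v\<close> and the lower bounds of the other
    forms are inserted.\<close>
  define C where "C = (\<Sum>v'\<in>?V - {v}. u v' * K v')"
  have upper: "v \<bullet> lat_pt z \<le> C / u v" if z: "\<alpha> + cv z \<in> same_Fplus_class \<alpha>" for z
  proof -
    have "0 = (\<Sum>v'\<in>?V. u v' *\<^sub>R v') \<bullet> lat_pt z" by (simp add: u(3))
    also have "\<dots> = (\<Sum>v'\<in>?V. u v' * (v' \<bullet> lat_pt z))" by (simp add: inner_sum_left)
    also have "\<dots> = u v * (v \<bullet> lat_pt z) + (\<Sum>v'\<in>?V - {v}. u v' * (v' \<bullet> lat_pt z))"
      using finV v(1) by (rule sum.remove)
    finally have "u v * (v \<bullet> lat_pt z) = (\<Sum>v'\<in>?V - {v}. u v' * - (v' \<bullet> lat_pt z))"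
      by (simp add: sum_negf)
    also have "\<dots> \<le> C"
      unfolding C_def
    proof (rule sum_mono)
      fix v' assume "v' \<in> ?V - {v}"
      then show "u v' * - (v' \<bullet> lat_pt z) \<le> u v' * K v'"
        using K[of v' z] z u(1) by (intro mult_left_mono) auto
    qed
    finally show ?thesis using uv by (simp add: field_simps)
  qed
  obtain \<sigma> m where \<sigma>: "\<sigma> \<in> facets A" "v = Fvec A \<sigma> \<or> v = - Fvec A \<sigma>" "Fc A \<sigma> \<alpha> = of_int m"
    using v(1) by (auto simp: Fplus_iff Fminus_iff)
  define N where "N = \<lceil>max \<bar>K v\<bar> \<bar>C / u v\<bar>\<rceil>"
  have bound: "\<bar>form \<sigma> z\<bar> \<le> N" if z: "\<alpha> + cv z \<in> same_Fplus_class \<alpha>" for z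
  proof -
    have "\<bar>v \<bullet> lat_pt z\<bar> \<le> max \<bar>K v\<bar> \<bar>C / u v\<bar>"
      using upper[OF z] K[OF v(1) z] by linarith
    moreover have "\<bar>v \<bullet> lat_pt z\<bar> = \<bar>of_int (form \<sigma> z)\<bar>"
      using \<sigma>(2) by (auto simp: of_int_form[OF \<sigma>(1)])
    ultimately have "of_int \<bar>form \<sigma> z\<bar> \<le> max \<bar>K v\<bar> \<bar>C / u v\<bar>" by simp
    then show ?thesis unfolding N_def by linarith
  qed
  \<comment> \<open>At a point \<alpha> + z of the class the form of \<sigma> has the value m + form
    \<sigma> z, within \<open>N\<close> of \<open>m\<close>. The other facets contribute empty
    products.\<close>
  define M where "M = (\<lambda>\<tau>. if \<tau> = \<sigma> then {m - N..m + N} else {})"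
  show ?thesis
  proof (intro bexI conjI ballI)
    show "hyperplanes_poly M \<in> polyfun" by (rule hyperplanes_poly_polyfun)
    show "\<exists>x. hyperplanes_poly M x \<noteq> 0" by (rule hyperplanes_poly_nonzero) (simp add: M_def)
    fix \<beta> assume "\<beta> \<in> same_Fplus_class \<alpha>"
    then obtain z where z: "\<beta> = \<alpha> + cv z" "\<alpha> + cv z \<in> same_Fplus_class \<alpha>"
      by (auto simp: same_Fplus_class_def)
    have "m + form \<sigma> z \<in> M \<sigma>" using bound[OF z(2)] by (auto simp: M_def)
    moreover have "Fc A \<sigma> \<beta> = of_int (m + form \<sigma> z)"
      by (simp add: z(1) Fc_add Fc_cv \<sigma>)
    ultimately show "hyperplanes_poly M \<beta> = 0"
      using \<sigma>(1) hyperplanes_poly_eq_0_iff[of M \<beta>] by (metis M_def finite.emptyI finite_atLeastAtMost_int)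
  qed
qed

text \<open>By \<open>Fplus_mono\<close> the class of \<open>\<alpha>\<close> spans a subquotient of the \<open>D(R\<^sub>A)\<close>-module
  \<open>t\<^sup>\<alpha> \<complex>[t\<^sup>\<plusminus>\<^sup>1]\<close>; the ideal below is its annihilator.\<close>

lemma Rpos_nonempty_if_simple:
  assumes simple: "simple_alg (D_R A)"
  shows "Rpos A \<alpha> \<noteq> {}"
proof
  assume empty: "Rpos A \<alpha> = {}"
  let ?E = "same_Fplus_class \<alpha>"
  define I where "I = {P \<in> D_R A. \<forall>a \<beta>. \<beta> \<in> ?E \<longrightarrow> \<beta> + cv a \<in> ?E \<longrightarrow> symbol P a \<beta> = 0}"
  \<comment> \<open>\<open>Fplus\<close> grows along \<beta>, \<beta> + a, \<beta> + d if both
    coefficients are nonzero, so when the ends are in the class, the middle is too. Hence products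
    of operators can be computed inside the class, which makes \<open>I\<close> an ideal.\<close>
  have through: "symbol P (d - a) (\<beta> + cv a) * symbol Q a \<beta> = 0"
    if prems: "P \<in> D_R A" "Q \<in> D_R A" "\<beta> \<in> ?E" "\<beta> + cv d \<in> ?E" "\<beta> + cv a \<notin> ?E" for P Q a d \<beta>
  proof (rule ccontr)
    assume ne: "symbol P (d - a) (\<beta> + cv a) * symbol Q a \<beta> \<noteq> 0"
    have "\<beta> + cv a + cv (d - a) = \<beta> + cv d" by (simp add: add.assoc flip: cv_add)
    then have "Fplus A (\<beta> + cv a) \<subseteq> Fplus A (\<beta> + cv d)"
      using ne Fplus_mono[OF prems(1), of "d - a" "\<beta> + cv a"] by (metis mult_eq_0_iff)
    moreover have "Fplus A \<beta> \<subseteq> Fplus A (\<beta> + cv a)"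
      using ne by (intro Fplus_mono[OF prems(2)]) auto
    ultimately have "Fplus A (\<beta> + cv a) = Fplus A \<beta>"
      using prems(3,4) by (auto simp: same_Fplus_class_def)
    then have "Fplus A (\<beta> + cv a) = Fplus A \<alpha>"
      using that by (auto simp: same_Fplus_class_def)
    moreover obtain z where "\<beta> = \<alpha> + cv z" using prems(3) by (auto simp: same_Fplus_class_def)
    then have "\<beta> + cv a = \<alpha> + cv (z + a)" by (simp add: cv_add)
    ultimately show False using prems(5) by (auto simp: same_Fplus_class_def)
  qed
  have I: "two_sided_ideal (D_R A) I"
    unfolding two_sided_ideal_def
  proof (intro conjI ballI)
    show "I \<subseteq> D_R A" by (auto simp: I_def)
    have "homop 0 (\<lambda>_. 0) \<in> D_R A" by (intro homop_0_in_D_R polyfun.const)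
    moreover have "symbol (homop (0::int^'n) (\<lambda>_. 0)) a \<beta> = 0" for a \<beta>
      by (simp add: symbol_homop polyfun.const)
    ultimately show "(\<lambda>_. 0) \<in> I" by (simp add: I_def homop_zero)
  next
    fix P Q assume "P \<in> I" "Q \<in> I"
    then show "(\<lambda>f. P f - Q f) \<in> I"
      unfolding I_def by (auto intro: D_R_diff simp: symbol_diff D_R_weyl_ops)
  next
    fix P Q assume P: "P \<in> D_R A" and Q: "Q \<in> I"
    then have QD: "Q \<in> D_R A"
      and Q_zero: "\<And>a \<beta>. \<beta> \<in> ?E \<Longrightarrow> \<beta> + cv a \<in> ?E \<Longrightarrow> symbol Q a \<beta> = 0"
      by (simp_all add: I_def)
    have "symbol P (d - a) (\<beta> + cv a) * symbol Q a \<beta> = 0" if "\<beta> \<in> ?E" "\<beta> + cv d \<in> ?E" for a d \<beta>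
      using through[OF P QD that, of a] Q_zero[OF that(1), of a] by (cases "\<beta> + cv a \<in> ?E") auto
    then show "P \<circ> Q \<in> I"
      unfolding I_def using P QD
      by (auto simp: symbol_comp D_R_weyl_ops D_R_comp simp del: mult_eq_0_iff intro!: sum.neutral)
    have "symbol Q (d - a) (\<beta> + cv a) * symbol P a \<beta> = 0" if "\<beta> \<in> ?E" "\<beta> + cv d \<in> ?E" for a d \<beta>
    proof (cases "\<beta> + cv a \<in> ?E")
      case True
      have "\<beta> + cv a + cv (d - a) = \<beta> + cv d" by (simp add: add.assoc flip: cv_add)
      with Q_zero[OF True, of "d - a"] that(2) show ?thesis by simp
    qed (rule through[OF QD P that])
    then show "Q \<circ> P \<in> I"
      unfolding I_def using P QD
      by (auto simp: symbol_comp D_R_weyl_ops D_R_comp simp del: mult_eq_0_iff intro!: sum.neutral)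
  qed
  have \<alpha>: "\<alpha> \<in> ?E" by (auto simp: same_Fplus_class_def intro: exI[of _ 0])
  have "symbol (homop 0 (\<lambda>_. 1)) 0 \<alpha> = 1" by (simp add: symbol_homop polyfun.const)
  then have one: "homop 0 (\<lambda>_. 1) \<notin> I" using \<alpha> by (auto simp: I_def intro!: exI[of _ 0] exI[of _ \<alpha>])
  obtain f x where f: "f \<in> polyfun" "f x \<noteq> 0" "\<forall>\<beta>\<in>?E. f \<beta> = 0"
    using same_Fplus_class_in_hyperplanes[OF empty] by blast
  then have "homop 0 f \<in> I" by (auto simp: I_def homop_0_in_D_R symbol_homop)
  with simple_D_R_proper_ideal_trivial[OF simple I one f(1)] f(2) show False by simp
qed

section \<open>Sufficiency of the two conditions\<close>

definition shift_poly :: "int^'n \<Rightarrow> complex^'n \<Rightarrow> complex" where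
  "shift_poly a = hyperplanes_poly (\<lambda>\<sigma>. {m \<in> formNA \<sigma>. m + form \<sigma> a \<notin> formNA \<sigma>})"

text \<open>The value set is bounded below by 0 and contains all large integers, so a fixed shift
  moves only finitely many values out of it.\<close>

lemma finite_shift_exceptions:
  assumes \<sigma>: "\<sigma> \<in> facets A" shows "finite {m \<in> formNA \<sigma>. m + form \<sigma> a \<notin> formNA \<sigma>}"
proof -
  obtain K where K: "\<forall>m\<ge>K. m \<in> formNA \<sigma>" using formNA_cofinite[OF \<sigma>] by blast
  have "{m \<in> formNA \<sigma>. m + form \<sigma> a \<notin> formNA \<sigma>} \<subseteq> {0..K - form \<sigma> a}"
  proof
    fix m assume m: "m \<in> {m \<in> formNA \<sigma>. m + form \<sigma> a \<notin> formNA \<sigma>}"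
    then have "0 \<le> m" using form_NA_nonneg[OF \<sigma>] by (auto simp: formNA_def)
    moreover have "\<not> K \<le> m + form \<sigma> a" using m K by blast
    ultimately show "m \<in> {0..K - form \<sigma> a}" by simp
  qed
  then show ?thesis by (rule finite_subset) simp
qed

lemma shift_poly_eq_0_iff:
  "shift_poly a x = 0 \<longleftrightarrow>
    (\<exists>\<sigma>\<in>facets A. \<exists>m\<in>formNA \<sigma>. m + form \<sigma> a \<notin> formNA \<sigma> \<and> Fc A \<sigma> x = of_int m)"
  unfolding shift_poly_def by (subst hyperplanes_poly_eq_0_iff) (auto simp: finite_shift_exceptions)

lemma shift_poly_polyfun: "shift_poly a \<in> polyfun"
  unfolding shift_poly_def by (rule hyperplanes_poly_polyfun)

lemma shift_poly_nonzero: "\<exists>x. shift_poly a x \<noteq> 0"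
  unfolding shift_poly_def by (rule hyperplanes_poly_nonzero) (rule finite_shift_exceptions)

text \<open>In a scored monoid, b + a can leave \<nat>A only by some facet value leaving its value
  set. This yields operators of every degree whose zeros are known exactly.\<close>

lemma homop_shift_poly_in_D_R:
  assumes "scored A" shows "homop a (shift_poly a) \<in> D_R A"
  unfolding homop_in_D_R_iff[OF shift_poly_polyfun]
proof (intro ballI impI)
  fix b assume b: "b \<in> NA A" "b + a \<notin> NA A"
  then obtain \<sigma> where "\<sigma> \<in> facets A" "form \<sigma> (b + a) \<notin> formNA \<sigma>"
    using assms by (auto simp: scored_iff)
  with b(1) show "shift_poly a (cv b) = 0"
    unfolding shift_poly_eq_0_iff
    by (intro bexI[of _ \<sigma>] bexI[of _ "form \<sigma> b"]) (auto simp: formNA_def form_add Fc_cv)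
qed

text \<open>Rounding a large multiple of a point of the open cone \<open>Rpos A \<alpha>\<close> gives a lattice point so deep
  inside that adding unit vectors does not leave the cone.\<close>

lemma ex_deep_lattice_point:
  assumes \<gamma>: "\<gamma> \<in> Rpos A \<alpha>"
  shows "\<exists>c::int^'n. (\<forall>\<sigma>\<in>Fplus A \<alpha>. C \<le> form \<sigma> c) \<and> (\<forall>\<sigma>\<in>Fminus A \<alpha>. form \<sigma> c \<le> - C)"
proof -
  have fin: "finite (Fplus A \<alpha>)" "finite (Fminus A \<alpha>)"
    using finite_facets by (auto simp: Fplus_def Fminus_def)
  \<comment> \<open>The l1 norm of the form bounds the rounding error, since each coordinate moves
    by less than 1.\<close>
  define L where "L = (\<lambda>\<sigma>. \<Sum>i\<in>UNIV. \<bar>Fvec A \<sigma> $ i\<bar>)"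
  have ev: "\<forall>\<^sub>F r in at_top. of_int C + L \<sigma> \<le> r * y" if "0 < y" for y \<sigma>
  proof (rule eventually_mono[OF eventually_ge_at_top[of "(of_int C + L \<sigma>) / y"]])
    fix r assume "(of_int C + L \<sigma>) / y \<le> r"
    then show "of_int C + L \<sigma> \<le> r * y" using that by (simp add: field_simps)
  qed
  have "\<forall>\<^sub>F r in at_top. (\<forall>\<sigma>\<in>Fplus A \<alpha>. of_int C + L \<sigma> \<le> r * F A \<sigma> \<gamma>)
      \<and> (\<forall>\<sigma>\<in>Fminus A \<alpha>. of_int C + L \<sigma> \<le> r * - F A \<sigma> \<gamma>)"
    using \<gamma> by (intro eventually_conj eventually_ball_finite fin ballI ev) (auto simp: Rpos_def)
  then obtain r where r: "\<forall>\<sigma>\<in>Fplus A \<alpha>. of_int C + L \<sigma> \<le> r * F A \<sigma> \<gamma>"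
      "\<forall>\<sigma>\<in>Fminus A \<alpha>. of_int C + L \<sigma> \<le> r * - F A \<sigma> \<gamma>"
    using eventually_happens'[OF trivial_limit_at_top_linorder] by blast
  define c where "c = (\<chi> i. \<lfloor>r * \<gamma> $ i\<rfloor>)"
  have near: "\<bar>Fvec A \<sigma> \<bullet> lat_pt c - r * F A \<sigma> \<gamma>\<bar> \<le> L \<sigma>" for \<sigma>
  proof -
    have "Fvec A \<sigma> \<bullet> lat_pt c - r * F A \<sigma> \<gamma> = (\<Sum>i\<in>UNIV. Fvec A \<sigma> $ i * - frac (r * \<gamma> $ i))"
      by (simp add: F_def inner_vec_def c_def frac_def sum_distrib_left sum_subtractf[symmetric] algebra_simps)
    also have "\<bar>\<dots>\<bar> \<le> (\<Sum>i\<in>UNIV. \<bar>Fvec A \<sigma> $ i * - frac (r * \<gamma> $ i)\<bar>)" by (rule sum_abs)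
    also have "\<dots> \<le> L \<sigma>"
      unfolding L_def
    proof (rule sum_mono)
      fix i
      show "\<bar>Fvec A \<sigma> $ i * - frac (r * \<gamma> $ i)\<bar> \<le> \<bar>Fvec A \<sigma> $ i\<bar>"
        using frac_ge_0[of "r * \<gamma> $ i"] frac_lt_1[of "r * \<gamma> $ i"]
        by (simp add: abs_mult mult_left_le)
    qed
    finally show ?thesis .
  qed
  show ?thesis
  proof (intro exI conjI ballI)
    fix \<sigma> assume \<sigma>: "\<sigma> \<in> Fplus A \<alpha>"
    then have "of_int C \<le> Fvec A \<sigma> \<bullet> lat_pt c" using r(1) near[of \<sigma>] by (auto simp: abs_le_iff)
    then show "C \<le> form \<sigma> c" by (simp add: form_def le_floor_iff)
  next
    fix \<sigma> assume \<sigma>: "\<sigma> \<in> Fminus A \<alpha>"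
    then have "Fvec A \<sigma> \<bullet> lat_pt c \<le> - of_int C" using r(2) near[of \<sigma>] by (auto simp: abs_le_iff)
    then have "\<lfloor>Fvec A \<sigma> \<bullet> lat_pt c\<rfloor> \<le> \<lfloor>- of_int C :: real\<rfloor>" by (rule floor_mono)
    then show "form \<sigma> c \<le> - C" by (simp add: form_def floor_minus)
  qed
qed

text \<open>A deep point \<open>c\<close> and its neighbours c + e_i stay in the cone and span, each
  e_i being a difference of two of them. The index \<open>None\<close> stands for
  \<open>c\<close>.\<close>

lemma ex_spanning_lattice_points:
  assumes \<gamma>: "\<gamma> \<in> Rpos A \<alpha>"
  shows "\<exists>v :: 'n option \<Rightarrow> int^'n.
    (\<forall>\<sigma>\<in>Fplus A \<alpha>. \<forall>j. 1 \<le> form \<sigma> (v j)) \<and> (\<forall>\<sigma>\<in>Fminus A \<alpha>. \<forall>j. form \<sigma> (v j) \<le> - 1)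
    \<and> (\<forall>x. \<exists>z. x = (\<Sum>j\<in>UNIV. z j *s cv (v j)))"
proof -
  \<comment> \<open>Exceeds every value of a facet form on a unit vector by at least 1, so adding
    the vector leaves a value of at least 1 in absolute terms.\<close>
  define C where "C = 1 + (\<Sum>\<sigma>\<in>facets A. \<Sum>i\<in>UNIV. \<bar>form \<sigma> (axis i 1)\<bar>)"
  have C: "\<bar>form \<sigma> (axis i 1)\<bar> \<le> C - 1" if "\<sigma> \<in> facets A" for \<sigma> i
  proof -
    have "\<bar>form \<sigma> (axis i 1)\<bar> \<le> (\<Sum>i\<in>UNIV. \<bar>form \<sigma> (axis i 1)\<bar>)" by (intro member_le_sum) auto
    also have "\<dots> \<le> (\<Sum>\<sigma>\<in>facets A. \<Sum>i\<in>UNIV. \<bar>form \<sigma> (axis i 1)\<bar>)"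
      using that finite_facets
      by (intro member_le_sum[of \<sigma> _ "\<lambda>\<sigma>. \<Sum>i\<in>UNIV. \<bar>form \<sigma> (axis i 1)\<bar>"]) (auto intro: sum_nonneg)
    finally show ?thesis by (simp add: C_def)
  qed
  have C1: "1 \<le> C" by (simp add: C_def sum_nonneg)
  obtain c where c: "\<And>\<sigma>. \<sigma> \<in> Fplus A \<alpha> \<Longrightarrow> C \<le> form \<sigma> c" "\<And>\<sigma>. \<sigma> \<in> Fminus A \<alpha> \<Longrightarrow> form \<sigma> c \<le> - C"
    using ex_deep_lattice_point[OF \<gamma>] by metis
  define v where "v = case_option c (\<lambda>i. c + axis i 1)"
  have "1 \<le> form \<sigma> (v j)" if \<sigma>: "\<sigma> \<in> Fplus A \<alpha>" for \<sigma> j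
  proof -
    have "\<sigma> \<in> facets A" using \<sigma> by (simp add: Fplus_def)
    then show ?thesis using c(1)[OF \<sigma>] C1 C[of \<sigma> "the j"]
      by (cases j) (simp_all add: v_def form_add abs_le_iff)
  qed
  moreover have "form \<sigma> (v j) \<le> - 1" if \<sigma>: "\<sigma> \<in> Fminus A \<alpha>" for \<sigma> j
  proof -
    have "\<sigma> \<in> facets A" using \<sigma> by (simp add: Fminus_def)
    then show ?thesis using c(2)[OF \<sigma>] C1 C[of \<sigma> "the j"]
      by (cases j) (simp_all add: v_def form_add abs_le_iff)
  qed
  moreover have "\<exists>z. x = (\<Sum>j\<in>UNIV. z j *s cv (v j))" for x :: "complex^'n"
  proof
    \<comment> \<open>The coefficient at \<open>None\<close> cancels the copies of \<open>c\<close>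
      brought in by the neighbours.\<close>
    define z where "z = case_option (- (\<Sum>i\<in>UNIV. x $ i)) (\<lambda>i. x $ i)"
    have ax: "cv (axis i 1) = axis i 1" for i :: 'n
      by (simp add: vec_eq_iff axis_def)
    have "(\<Sum>j\<in>UNIV. z j *s cv (v j))
        = z None *s cv (v None) + (\<Sum>i\<in>UNIV. z (Some i) *s cv (v (Some i)))"
      unfolding UNIV_option_conv by (subst sum.insert) (auto simp: sum.reindex)
    also have "\<dots> = (\<Sum>i\<in>UNIV. x $ i *s axis i 1)"
      by (simp add: z_def v_def cv_add ax vec_eq_iff algebra_simps sum.distrib sum_distrib_left sum_distrib_right)
    also have "\<dots> = x" by (rule basis_expansion)
    finally show "x = (\<Sum>j\<in>UNIV. z j *s cv (v j))" by simp
  qed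
  ultimately show ?thesis by blast
qed

text \<open>Large natural combinations of the spanning points push the values at
  \<open>Fplus\<close> into the cofinite part of the value set and those at \<open>Fminus\<close>
  below 0, so no membership changes. These combinations are Zariski dense.\<close>

lemma polyfun_zero_if_zero_on_shifts:
  assumes ne: "Rpos A \<alpha> \<noteq> {}" and f: "f \<in> polyfun"
    and zero: "\<And>a. (\<And>\<sigma> m. \<sigma> \<in> facets A \<Longrightarrow> Fc A \<sigma> \<alpha> = of_int m \<Longrightarrow>
      m \<in> formNA \<sigma> \<longleftrightarrow> m + form \<sigma> a \<in> formNA \<sigma>) \<Longrightarrow> f (\<alpha> + cv a) = 0"
  shows "f x = 0"
proof -
  obtain \<gamma> where "\<gamma> \<in> Rpos A \<alpha>" using ne by blast
  then obtain v :: "'n option \<Rightarrow> int^'n" where v: "\<forall>\<sigma>\<in>Fplus A \<alpha>. \<forall>j. 1 \<le> form \<sigma> (v j)"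
    "\<forall>\<sigma>\<in>Fminus A \<alpha>. \<forall>j. form \<sigma> (v j) \<le> - 1"
    and span: "\<forall>x. \<exists>z. x = (\<Sum>j\<in>UNIV. z j *s cv (v j))"
    using ex_spanning_lattice_points[of \<gamma> \<alpha>] by blast
  obtain k where k: "\<And>\<sigma> m. \<sigma> \<in> facets A \<Longrightarrow> k \<sigma> \<le> m \<Longrightarrow> m \<in> formNA \<sigma>"
    using formNA_cofinite by metis
  \<comment> \<open>Recovers F_\<sigma>(\<alpha>) as an integer wherever it is one; a definition for
    all facets lets a single \<open>K\<close> serve them all.\<close>
  define l where "l \<sigma> = \<lfloor>Re (Fc A \<sigma> \<alpha>)\<rfloor>" for \<sigma>
  \<comment> \<open>Makes m + K reach the threshold \<open>k \<sigma>\<close> and m - K negative for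
    every facet with integral value \<open>m\<close>; the summand 1 gives strictness.\<close>
  define K where "K = nat (\<Sum>\<sigma>\<in>facets A. \<bar>k \<sigma>\<bar> + \<bar>l \<sigma>\<bar> + 1)"
  have K: "\<bar>k \<sigma>\<bar> + \<bar>l \<sigma>\<bar> + 1 \<le> int K" if "\<sigma> \<in> facets A" for \<sigma>
  proof -
    have "\<bar>k \<sigma>\<bar> + \<bar>l \<sigma>\<bar> + 1 \<le> (\<Sum>\<sigma>\<in>facets A. \<bar>k \<sigma>\<bar> + \<bar>l \<sigma>\<bar> + 1)"
      using that finite_facets by (intro member_le_sum) auto
    then show ?thesis unfolding K_def by linarith
  qed
  obtain z where z: "x - \<alpha> = (\<Sum>j\<in>UNIV. z j *s cv (v j))" using span by blast
  have "f (\<alpha> + (\<Sum>j\<in>UNIV. z j *s cv (v j))) = 0"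
  proof (rule polyfun_zero_on_lattice_cone[OF f, where K = K])
    fix n :: "'n option \<Rightarrow> nat" assume n: "\<forall>j\<in>UNIV. K \<le> n j"
    define a where "a = (\<Sum>j\<in>UNIV. int (n j) *s v j)"
    have "int K \<le> int (n None)" using n by simp
    have "f (\<alpha> + cv a) = 0"
    proof (rule zero)
      fix \<sigma> m assume \<sigma>: "\<sigma> \<in> facets A" and m: "Fc A \<sigma> \<alpha> = of_int m"
      have lm: "l \<sigma> = m" by (simp add: l_def m)
      have form_a: "form \<sigma> a = (\<Sum>j\<in>UNIV. int (n j) * form \<sigma> (v j))"
        by (simp add: a_def form_sum[OF \<sigma>] form_scale[OF \<sigma>])
      show "m \<in> formNA \<sigma> \<longleftrightarrow> m + form \<sigma> a \<in> formNA \<sigma>"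
      proof (cases "m \<in> formNA \<sigma>")
        case True
        then have "\<sigma> \<in> Fplus A \<alpha>" using \<sigma> m by (auto simp: Fplus_iff)
        have "int (n None) \<le> (\<Sum>j\<in>UNIV. int (n j))" by (intro member_le_sum) auto
        also have "\<dots> \<le> (\<Sum>j\<in>UNIV. int (n j) * form \<sigma> (v j))"
          using v(1) \<open>\<sigma> \<in> Fplus A \<alpha>\<close> by (intro sum_mono) (simp add: mult_le_cancel_left1)
        finally have "int K \<le> form \<sigma> a" using \<open>int K \<le> int (n None)\<close> form_a by simp
        then have "k \<sigma> \<le> m + form \<sigma> a" using K[OF \<sigma>] lm by linarith
        with k \<sigma> True show ?thesis by blast
      next
        case False
        then have "\<sigma> \<in> Fminus A \<alpha>" using \<sigma> m by (auto simp: Fminus_iff)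
        have "form \<sigma> a \<le> (\<Sum>j\<in>UNIV. - int (n j))"
          unfolding form_a
        proof (rule sum_mono)
          fix j
          have "int (n j) * form \<sigma> (v j) \<le> int (n j) * - 1"
            using v(2) \<open>\<sigma> \<in> Fminus A \<alpha>\<close> by (intro mult_left_mono) auto
          then show "int (n j) * form \<sigma> (v j) \<le> - int (n j)" by simp
        qed
        moreover have "int (n None) \<le> (\<Sum>j\<in>UNIV. int (n j))" by (intro member_le_sum) auto
        ultimately have "form \<sigma> a \<le> - int K" using \<open>int K \<le> int (n None)\<close> by (simp add: sum_negf)
        then have "m + form \<sigma> a < 0" using K[OF \<sigma>] lm by linarith
        then have "m + form \<sigma> a \<notin> formNA \<sigma>"
          by (fastforce simp: formNA_def dest: form_NA_nonneg[OF \<sigma>])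
        with False show ?thesis by simp
      qed
    qed
    then show "f (\<alpha> + (\<Sum>j\<in>UNIV. of_nat (n j) *s cv (v j))) = 0"
      by (simp add: a_def cv_sum cv_scale)
  qed simp
  then show ?thesis by (simp flip: z)
qed

lemma simple_if_scored_and_Rpos_nonempty:
  assumes scored: "scored A" and Rpos: "\<And>\<alpha>. Rpos A \<alpha> \<noteq> {}"
  shows "simple_alg (D_R A)"
  unfolding simple_alg_def
proof (intro allI impI)
  fix I assume I: "two_sided_ideal (D_R A) I"
  note shift_D = homop_shift_poly_in_D_R[OF scored]
  show "I = {\<lambda>_. 0} \<or> I = D_R A"
  proof (cases "I = {\<lambda>_. 0}")
    case False
    define J where "J = {p \<in> polyfun. homop 0 p \<in> I}"
    have J: "poly_ideal J"
      unfolding poly_ideal_def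
    proof (intro conjI ballI)
      show "J \<subseteq> polyfun" by (auto simp: J_def)
      show "(\<lambda>_. 0) \<in> J"
        using I by (simp add: J_def homop_zero polyfun.const two_sided_ideal_def)
    next
      fix p q assume pq: "p \<in> J" "q \<in> J"
      \<comment> \<open>Two-sided ideals are given as closed under differences, so the sum is
        written as p - (-1) q.\<close>
      then have "(\<lambda>g. homop 0 p g - (homop 0 (\<lambda>_. -1) \<circ> homop 0 q) g) \<in> I"
        by (intro ideal_diff[OF I] ideal_comp_left[OF I] homop_0_in_D_R polyfun.const) (auto simp: J_def)
      also have "homop 0 (\<lambda>_. -1) \<circ> homop 0 q = homop 0 (\<lambda>x. - q x)"
        using pq by (subst homop_comp) (auto simp: J_def polyfun.const)
      also have "(\<lambda>g. homop 0 p g - homop 0 (\<lambda>x. - q x) g) = homop 0 (\<lambda>x. p x + q x)"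
        by (auto simp: homop_def fun_eq_iff sum_subtractf[symmetric] single_diff[symmetric] algebra_simps)
      finally show "(\<lambda>x. p x + q x) \<in> J" using pq by (auto simp: J_def intro: polyfun.add)
    next
      fix p q :: "complex^'n \<Rightarrow> complex" assume pq: "p \<in> J" "q \<in> polyfun"
      then have "homop 0 q \<circ> homop 0 p \<in> I"
        by (intro ideal_comp_left[OF I] homop_0_in_D_R) (auto simp: J_def)
      then show "(\<lambda>x. q x * p x) \<in> J" using pq by (auto simp: J_def homop_comp intro: polyfun.mult)
    qed
    obtain a p where p: "p \<in> polyfun" "p \<noteq> (\<lambda>_. 0)" "homop a p \<in> I"
      using ideal_contains_homop[OF I False] by blast
    \<comment> \<open>An operator of degree -a on the left brings t^a p(\<theta>) to degree 0; the
      result is nonzero as a product of nonzero polynomials.\<close>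
    define f where "f = (\<lambda>x. shift_poly (- a) (x + cv a) * p x)"
    have f: "f \<in> polyfun"
      unfolding f_def by (intro polyfun.mult polyfun_translate shift_poly_polyfun p)
    have "homop (- a) (shift_poly (- a)) \<circ> homop a p \<in> I"
      by (intro ideal_comp_left[OF I] shift_D p)
    then have fJ: "f \<in> J" using f p by (simp add: J_def f_def homop_comp shift_poly_polyfun)
    obtain y where "p y \<noteq> 0" using p(2) by blast
    obtain y' where "shift_poly (- a) y' \<noteq> 0" using shift_poly_nonzero by blast
    then have "shift_poly (- a) ((y' - cv a) + cv a) \<noteq> 0" by simp
    from polyfun_nonzero_mult[OF polyfun_translate[OF shift_poly_polyfun] p(1) this \<open>p y \<noteq> 0\<close>]
    obtain x0 where x0: "f x0 \<noteq> 0" unfolding f_def by blast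
    \<comment> \<open>f(\<theta>) is multiplied by operators of degree b and -b. At a common zero
      \<alpha> of \<open>J\<close> the two outer factors are nonzero if shifting by \<open>b\<close>
      changes no membership, which forces f(\<alpha> + b) = 0.\<close>
    have shift: "(\<lambda>x. shift_poly (- b) (x + cv b) * (f (x + cv b) * shift_poly b x)) \<in> J" for b
    proof -
      have "homop (- b) (shift_poly (- b)) \<circ> (homop 0 f \<circ> homop b (shift_poly b)) \<in> I"
        using fJ by (intro ideal_comp_left[OF I] ideal_comp_right[OF I] shift_D) (auto simp: J_def)
      moreover have "(\<lambda>x. shift_poly (- b) (x + cv b) * (f (x + cv b) * shift_poly b x)) \<in> polyfun"
        by (intro polyfun.mult polyfun_translate shift_poly_polyfun f)
      ultimately show ?thesis
        by (simp add: J_def homop_comp f shift_poly_polyfun polyfun.mult polyfun_translate)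
    qed
    have "(\<lambda>_. 1) \<in> J"
    proof (rule ccontr)
      assume "(\<lambda>_. 1) \<notin> J"
      with weak_nullstellensatz[OF J] obtain \<alpha> where \<alpha>: "\<And>q. q \<in> J \<Longrightarrow> q \<alpha> = 0" by blast
      have "f x0 = 0"
      proof (rule polyfun_zero_if_zero_on_shifts[OF Rpos f])
        fix b assume b: "\<And>\<sigma> m. \<sigma> \<in> facets A \<Longrightarrow> Fc A \<sigma> \<alpha> = of_int m \<Longrightarrow>
          m \<in> formNA \<sigma> \<longleftrightarrow> m + form \<sigma> b \<in> formNA \<sigma>"
        have "shift_poly b \<alpha> \<noteq> 0" using b by (auto simp: shift_poly_eq_0_iff)
        moreover have "shift_poly (- b) (\<alpha> + cv b) \<noteq> 0"
        proof
          assume "shift_poly (- b) (\<alpha> + cv b) = 0"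
          then obtain \<sigma> m where \<sigma>: "\<sigma> \<in> facets A" "m \<in> formNA \<sigma>" "m + form \<sigma> (- b) \<notin> formNA \<sigma>"
            "Fc A \<sigma> (\<alpha> + cv b) = of_int m" by (auto simp: shift_poly_eq_0_iff)
          have "form \<sigma> (- b) = - form \<sigma> b"
            using form_scale[OF \<sigma>(1), of "-1" b] by (simp only: vector_sneg_minus1[symmetric])
          moreover have "Fc A \<sigma> \<alpha> = of_int (m - form \<sigma> b)"
            using \<sigma>(4) by (simp add: Fc_add Fc_cv[OF \<sigma>(1)] algebra_simps)
          ultimately show False using b[OF \<sigma>(1), of "m - form \<sigma> b"] \<sigma>(2,3) by simp
        qed
        ultimately show "f (\<alpha> + cv b) = 0" using \<alpha>[OF shift[of b]] by simp
      qed
      with x0 show False by simp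
    qed
    then have one: "homop 0 (\<lambda>_. 1) \<in> I" by (simp add: J_def)
    have "D_R A \<subseteq> I"
    proof
      fix P assume "P \<in> D_R A"
      from ideal_comp_left[OF I this one] show "P \<in> I" by (simp add: homop_one comp_def)
    qed
    with ideal_subset[OF I] show ?thesis by blast
  qed simp
qed

end

theorem theorem8p24:
  fixes A :: "(int^'n::finite) set"
  assumes "finite A" and "int_span A = UNIV"
  shows "simple_alg (D_R A) \<longleftrightarrow> scored A \<and> (\<forall>\<alpha>::complex^'n. Rpos A \<alpha> \<noteq> {})"
proof -
  interpret lattice_gens A using assms by unfold_locales
  show ?thesis
    using scored_if_simple Rpos_nonempty_if_simple simple_if_scored_and_Rpos_nonempty by blast
qed

end
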